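(* Let $m\ge2$ and let $f_1,\dots,f_m:\mathbb{R}^n\to\mathbb{R}$ be differentiable with $L$-Lipschitz gradients and $\mathbb{E}[f_i(x_k)]\ge F_{\inf}>-\infty$ for all $i\in[m]$ and all iterates $x_k$. Assume that at every iterate $x_k$ and for all $i\in[m]$ $$\nabla f_i(x_k)=\mathbb{E}[\nabla f_i(x_k;\xi)],\qquad \mathbb{E}\|\nabla f_i(x_k;\xi)\|_2^2\le C_f^2,\qquad \mathbb{E}\|\nabla f_i(x_k;\xi)-\nabla f_i(x_k)\|_2^2\le\delta^2,$$ with $C_f>0$, $\delta\ge0$. Let $$M_*^2=(2+\ln m)m^2C_f^4+\left(\tfrac12+\ln m\right)m^2C_f^2\delta^2,\qquad M_1=\left(\frac{2\bar D_{\omega_z,Z}^2S}{S-\lceil rS\rceil+1}+2\right)\max\{\theta,\theta^{-1}\}M_*,$$ $M_f=\max_{i\in[m]}f_i(x_0)-F_{\inf}$. Run the MSMD method (defined in the context) with fixed inner step size $\gamma_s=\frac{\theta}{M_*\sqrt S}$, $\theta>0$, varying outer step size $\alpha_k=\frac{\rho}{k+1}$, $\rho>0$, and $P=\lceil rS\rceil$, $r\in(0,1)$. Put $A_{K-1}=\sum_{k=0}^{K-1}\alpha_k$. (a) If $S=(K+1)^2$, then $$\frac1{A_{K-1}}\sum_{k=0}^{K-1}\alpha_k\,\mathbb{E}\|d_k\|_2^2\le O\left(\frac{\max\left\{LmC_f^2\rho\pi^23^{-1},\,2M_f\rho^{-1}\right\}}{\ln(K+1)}\right).$$ (b) If $S=(k+1)^2$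 at outer iteration $k$, then, with the finite constants $\zeta(\tfrac32)=\sum_{k\ge1}k^{-3/2}$ and $\zeta(3)=\sum_{k\ge1}k^{-3}$, $$\frac1{A_{K-1}}\sum_{k=0}^{K-1}\alpha_k\,\mathbb{E}\|d_k\|_2^2\le O\left(\max\left\{LmC_f^2\rho\pi^23^{-1},\,2\zeta(\tfrac32)C_fM_1^{1/2},\,2\zeta(3)L\rho M_1,\,2M_f\rho^{-1}\right\}\frac{1}{\ln(K+1)}\right).$$
   Context: $\nabla f_i(x;\xi)$ is a stochastic gradient of $f_i$, $\xi$ a random vector with a fixed distribution supported on $\Xi$. In the assumptions on stochastic gradients, $\mathbb{E}$ is over $\xi$ with $x_k$ held fixed; elsewhere it is total expectation. $[m]=\{1,\dots,m\}$, $\Delta^m=\{\lambda\in\mathbb{R}^m:\lambda\ge0,\sum_i\lambda_i=1\}$, $C=\{d\in\mathbb{R}^n:\|d\|_2\le C_f\}$, $Z=C\times\Delta^m$. "$a_K\le O(b_K)$" means: there is a constant $c>0$ not depending on $K$ (it may depend on the fixed problem and method constants) with $a_K\le c\,b_K$ for all $K\ge1$. In (b), where $S$ depends on $k$, $M_1$ is read as the maximum of the displayed expression over $S=(k+1)^2$, $0\le k\le K-1$. Steepest common descent direction at $x_k$: $d_k=\arg\min_{d\in\mathbb{R}^n}\max_{i\in[m]}\nabla f_i(x_k)^Td+\frac12\|d\|_2^2$. Subproblem gradient at $x_k$: for $z=(d,\lambda)\in Z$, $$\nabla\phi_z(z;\xi)=\Big(\sum_{i=1}^m\lambda_i\nabla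 f_i(x_k;\xi)+d,\ -\big(\langle\nabla f_i(x_k;\xi),d\rangle\big)_{i=1}^m\Big)\in\mathbb{R}^{n}\times\mathbb{R}^m.$$ Bregman data: $\omega_z(d,\lambda)=\frac{1}{2C_f^2}\|d\|_2^2+\frac{1}{2\ln m}\sum_{i=1}^m\lambda_i\ln\lambda_i$ on $Z$ (with $0\ln0=0$), $V(u,v)=\omega_z(v)-\omega_z(u)-\nabla\omega_z(u)^T(v-u)$, prox-mapping $P_z(\zeta)=\arg\min_{u\in Z}\{\zeta^T(u-z)+V(z,u)\}$, and $\bar D_{\omega_z,Z}=\sup_{u,v\in Z}\sqrt{2V(u,v)}$. The paper takes $V(u,v)\le\frac12\bar D_{\omega_z,Z}^2<+\infty$ for all $u,v\in Z$. MSMD method (number of inner steps $S$, inner step sizes $\gamma_s$, outer step sizes $\alpha_k$, ratio $r\in(0,1)$, $P=\lceil rS\rceil$): given $x_0\in\mathbb{R}^n$, at outer iteration $k=0,\dots,K-1$ set $d_{k,0}=0$, $\lambda_{k,0}=(1/m,\dots,1/m)$; for $s=0,\dots,S-1$ draw an i.i.d. sample $\xi_s$ (independent of $x_k$ and of all earlier samples) and set $z_{k,s+1}=P_{z_{k,s}}(\gamma_s\nabla\phi_z(z_{k,s};\xi_s))$; then set $z_{k,P}^S=(d_{k,P}^S,\lambda_{k,P}^S)=\big(\sum_{s=P}^S\gamma_s z_{k,s}\big)/\sum_{s=P}^S\gamma_s$ and $x_{k+1}=x_k+\alpha_k d_{k,P}^S$.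
   Formalization: The diameter of Z is in fact infinite (V is unbounded as a simplex coordinate of u tends to 0), so it cannot be taken finite; part (b) is stated with every real D between 0 and the diameter in its place inside M_1, and no finiteness is assumed. *)

theory Defs
  imports "HOL-Probability.Probability"
begin

text \<open>
  Objectives are indexed by a finite type \<open>'m\<close>, so the number of objectives is \<open>CARD('m)\<close>;
  the decision space is \<open>real^'n\<close>.
\<close>

definition common_descent :: "('m::finite \<Rightarrow> real^'n) \<Rightarrow> real^'n" where
  "common_descent v = arg_min (\<lambda>d. (MAX i. v i \<bullet> d) + (norm d)\<^sup>2 / 2) (\<lambda>_. True)"

definition prob_simplex :: "(real^'m) set" where
  "prob_simplex = {l. (\<forall>i. 0 \<le> l $ i) \<and> (\<Sum>i\<in>UNIV. l $ i) = 1}"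

definition feasible :: "real \<Rightarrow> ((real^'n) \<times> (real^'m)) set" where
  "feasible Cf = cball 0 Cf \<times> prob_simplex"

text \<open>The convention \<open>0 ln 0 = 0\<close> is automatic, since the product has the factor \<open>0\<close>.\<close>

definition omega :: "real \<Rightarrow> (real^'n) \<times> (real^'m) \<Rightarrow> real" where
  "omega Cf = (\<lambda>(d, l). 1 / (2 * Cf\<^sup>2) * (norm d)\<^sup>2
      + 1 / (2 * ln (real CARD('m))) * (\<Sum>i\<in>UNIV. l $ i * ln (l $ i)))"

definition bregman :: "('a::real_normed_vector \<Rightarrow> real) \<Rightarrow> 'a \<Rightarrow> 'a \<Rightarrow> real" where
  "bregman w u v = w v - w u - frechet_derivative w (at u) (v - u)"

definition prox :: "('a::real_inner \<Rightarrow> real) \<Rightarrow> 'a set \<Rightarrow> 'a \<Rightarrow> 'a \<Rightarrow> 'a" where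
  "prox w Z z g = arg_min_on (\<lambda>u. g \<bullet> (u - z) + bregman w z u) Z"

text \<open>
  The divergence \<open>V(u,v)\<close> is only meaningful where the gradient of \<open>w\<close> exists at \<open>u\<close>; for
  \<open>omega\<close> on \<open>feasible\<close> these are the points with all simplex coordinates positive, and all
  iterates of the method are of this kind. The supremum is taken in the extended reals, because
  the entropy part of \<open>V(u,v)\<close> is unbounded as \<open>u\<close> approaches the relative boundary of the
  simplex. That supremum is therefore \<open>\<infinity>\<close>, so a finite diameter cannot be assumed
  consistently; bounds that increase with the diameter are instead stated for every real
  \<open>D\<close> below it, which gives them for the diameter itself whenever it is finite.
\<close>

definition bregman_diam :: "('a::real_normed_vector \<Rightarrow> real) \<Rightarrow> 'a set \<Rightarrow> ereal" where
  "bregman_diam w Z =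
     (SUP u\<in>{u \<in> Z. w differentiable (at u)}. SUP v\<in>Z. ereal (sqrt (2 * bregman w u v)))"

definition sub_grad :: "('m::finite \<Rightarrow> real^'n) \<Rightarrow> (real^'n) \<times> (real^'m) \<Rightarrow> (real^'n) \<times> (real^'m)" where
  "sub_grad v = (\<lambda>(d, l). ((\<Sum>i\<in>UNIV. l $ i *\<^sub>R v i) + d, - (\<chi> i. v i \<bullet> d)))"

text \<open>
  In the following, \<open>G i x \<xi>\<close> is the stochastic gradient of the \<open>i\<close>-th objective at \<open>x\<close>.
  The first recursion is the inner loop at a fixed outer point \<open>x\<close>, with step sizes \<open>\<gamma> s\<close> and
  samples \<open>X s\<close>.
\<close>

primrec inner_iter :: "real \<Rightarrow> ('m::finite \<Rightarrow> real^'n \<Rightarrow> 'x \<Rightarrow> real^'n) \<Rightarrow> (nat \<Rightarrow> real) \<Rightarrow>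
    real^'n \<Rightarrow> (nat \<Rightarrow> 'x) \<Rightarrow> nat \<Rightarrow> (real^'n) \<times> (real^'m)" where
  "inner_iter Cf G \<gamma> x X 0 = (0, \<chi> i. 1 / real CARD('m))"
| "inner_iter Cf G \<gamma> x X (Suc s) =
     prox (omega Cf) (feasible Cf) (inner_iter Cf G \<gamma> x X s)
       (\<gamma> s *\<^sub>R sub_grad (\<lambda>i. G i x (X s)) (inner_iter Cf G \<gamma> x X s))"

definition tail_average :: "(nat \<Rightarrow> real) \<Rightarrow> (nat \<Rightarrow> 'a::real_vector) \<Rightarrow> nat \<Rightarrow> nat \<Rightarrow> 'a" where
  "tail_average \<gamma> z P S = (1 / (\<Sum>s=P..S. \<gamma> s)) *\<^sub>R (\<Sum>s=P..S. \<gamma> s *\<^sub>R z s)"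

text \<open>
  The outer loop, as a function of one sample path \<open>X\<close>; \<open>X (k, s)\<close> is the sample drawn at inner
  step \<open>s\<close> of outer iteration \<open>k\<close>. The number of inner steps \<open>S k\<close> and the inner step sizes
  \<open>\<gamma> k s\<close> may depend on the outer iteration.
\<close>

primrec msmd :: "real \<Rightarrow> ('m::finite \<Rightarrow> real^'n \<Rightarrow> 'x \<Rightarrow> real^'n) \<Rightarrow> (nat \<Rightarrow> nat) \<Rightarrow> real \<Rightarrow>
    (nat \<Rightarrow> nat \<Rightarrow> real) \<Rightarrow> (nat \<Rightarrow> real) \<Rightarrow> real^'n \<Rightarrow> (nat \<times> nat \<Rightarrow> 'x) \<Rightarrow> nat \<Rightarrow> real^'n" where
  "msmd Cf G S r \<gamma> \<alpha> x0 X 0 = x0"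
| "msmd Cf G S r \<gamma> \<alpha> x0 X (Suc k) =
     msmd Cf G S r \<gamma> \<alpha> x0 X k + \<alpha> k *\<^sub>R
       fst (tail_average (\<gamma> k)
         (inner_iter Cf G (\<gamma> k) (msmd Cf G S r \<gamma> \<alpha> x0 X k) (\<lambda>s. X (k, s)))
         (nat \<lceil>r * real (S k)\<rceil>) (S k))"

definition Mstar :: "nat \<Rightarrow> real \<Rightarrow> real \<Rightarrow> real" where
  "Mstar m Cf \<delta> = sqrt ((2 + ln (real m)) * (real m)\<^sup>2 * Cf ^ 4
      + (1 / 2 + ln (real m)) * (real m)\<^sup>2 * Cf\<^sup>2 * \<delta>\<^sup>2)"

definition M1 :: "nat \<Rightarrow> real \<Rightarrow> real \<Rightarrow> real \<Rightarrow> real \<Rightarrow> real \<Rightarrow> nat \<Rightarrow> real" where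
  "M1 m Cf \<delta> \<theta> r D S =
     (2 * D\<^sup>2 * real S / (real S - of_int \<lceil>r * real S\<rceil> + 1) + 2) * max \<theta> (inverse \<theta>) * Mstar m Cf \<delta>"

definition iid_samples :: "'w measure \<Rightarrow> 'x measure \<Rightarrow> ('j \<Rightarrow> 'w \<Rightarrow> 'x) \<Rightarrow> bool" where
  "iid_samples M \<mu> \<xi> \<longleftrightarrow>
     prob_space.indep_vars M (\<lambda>_. \<mu>) \<xi> UNIV \<and> (\<forall>p. distr M \<mu> (\<xi> p) = \<mu>)"

text \<open>
  The assumptions on stochastic gradients at one fixed point \<open>x\<close>. The second moments are
  Lebesgue integrals in \<open>ennreal\<close>, so that the bounds include their finiteness.
\<close>

definition stoch_grad :: "'x measure \<Rightarrow> ('m \<Rightarrow> real^'n \<Rightarrow> real^'n) \<Rightarrow>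
    ('m \<Rightarrow> real^'n \<Rightarrow> 'x \<Rightarrow> real^'n) \<Rightarrow> real \<Rightarrow> real \<Rightarrow> real^'n \<Rightarrow> bool" where
  "stoch_grad \<mu> g G Cf \<delta> x \<longleftrightarrow> (\<forall>i.
     has_bochner_integral \<mu> (G i x) (g i x) \<and>
     (\<integral>\<^sup>+\<xi>. ennreal ((norm (G i x \<xi>))\<^sup>2) \<partial>\<mu>) \<le> ennreal (Cf\<^sup>2) \<and>
     (\<integral>\<^sup>+\<xi>. ennreal ((norm (G i x \<xi> - g i x))\<^sup>2) \<partial>\<mu>) \<le> ennreal (\<delta>\<^sup>2))"

text \<open>
  The assumptions at one random iterate \<open>x\<close>: the stochastic-gradient assumptions hold at almost
  every realisation of \<open>x\<close>, the lower bound holds in total expectation.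
\<close>

definition iterate_assms :: "'w measure \<Rightarrow> 'x measure \<Rightarrow> ('m \<Rightarrow> real^'n \<Rightarrow> real) \<Rightarrow>
    ('m \<Rightarrow> real^'n \<Rightarrow> real^'n) \<Rightarrow> ('m \<Rightarrow> real^'n \<Rightarrow> 'x \<Rightarrow> real^'n) \<Rightarrow>
    real \<Rightarrow> real \<Rightarrow> real \<Rightarrow> ('w \<Rightarrow> real^'n) \<Rightarrow> bool" where
  "iterate_assms M \<mu> f g G Cf \<delta> Finf x \<longleftrightarrow>
     (\<forall>i. Finf \<le> (\<integral>w. f i (x w) \<partial>M)) \<and> (AE w in M. stoch_grad \<mu> g G Cf \<delta> (x w))"

end

(*
  Let d and lam be the steepest common descent direction at x and its dual multipliers. The
  gradient field F of the subproblem satisfies <F(z), z - (d, lam)> >= |d' - d|^2 at every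
  z = (d', lam') in Z, because the subproblem is strongly convex in its first argument. Telescoping
  the three-point inequality of mirror descent from the starting point, where the divergence to any
  feasible point is at most 1, gives sum_{s <= S} E|d_s - d|^2 = O(sqrt S), so the tail average is
  within O(S^(-1/2)) of d in mean square. This argument does not involve the diameter of Z, which is
  infinite. Conditioning on x_k, the smoothness inequality then gives, for any single i,

    E f_i(x_{k+1}) <= E f_i(x_k) - alpha_k E|d_k|^2 + O(alpha_k S_k^(-1/4)) + O(alpha_k^2),

  and the error terms are summable, since S_k >= (k + 1)^2.

  The maximum on the right-hand side vanishes only in (a), when L = 0 and M_f = 0. Then the
  gradients are constant, and the first steps of the runs with K -> oo force d_0 = 0.
*)

theory Submission
  imports Defs
begin

section \<open>Mirror descent for the divergence of the subproblem\<close>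

text \<open>\<open>prox\<close> and \<open>common_descent\<close> are choices among minimisers, so
  positivity, measurability and integrability only become accessible once the minimisers are
  identified. The prox step turns out to be a projection in the direction and an exponential
  reweighting of the multipliers; it keeps every weight positive and is Borel measurable. Of the
  common descent direction, the outer loop integrates only the norm, which is Lipschitz in the
  gradients.

  Conditioning is carried out with Fubini on independent blocks of samples: past inner samples
  against the current one, and past rows against the current row.

  The exponent 1/4 arises because the mean-square gap, of order \<open>1 / sqrt S\<close>, is paired
  with a gradient, which takes its square root. With \<open>sqrt (S k) \<ge> k + 1\<close> the error
  is of order \<open>(k + 1) powr (- 3 / 2)\<close>.

  Constants may depend on all data except \<open>K\<close>. So it suffices to bound the weighted sum
  uniformly in \<open>K\<close>, to use that the step sizes sum to at least
  \<open>\<rho> * ln (K + 1)\<close>, and to bound the displayed maximum below by a positive number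
  free of \<open>K\<close>.\<close>

definition bregman_omega :: "real \<Rightarrow> (real^'n) \<times> (real^'m::finite) \<Rightarrow> (real^'n) \<times> (real^'m) \<Rightarrow> real" where
  "bregman_omega Cf z u = (norm (fst u - fst z))\<^sup>2 / (2 * Cf\<^sup>2)
     + 1 / (2 * ln (real CARD('m))) * (\<Sum>i\<in>UNIV. snd u $ i * (ln (snd u $ i) - ln (snd z $ i)))"

text \<open>Positive weights make \<open>omega Cf\<close> differentiable, so that the
  \<open>frechet_derivative\<close> inside \<open>bregman\<close> is a true gradient there.\<close>

definition positive_feasible :: "real \<Rightarrow> ((real^'n) \<times> (real^'m::finite)) set" where
  "positive_feasible Cf = {z \<in> feasible Cf. \<forall>i. 0 < snd z $ i}"

lemma has_derivative_omega:
  fixes z :: "(real^'n) \<times> (real^'m::finite)"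
  assumes "\<And>i. 0 < snd z $ i"
  shows "(omega Cf has_derivative (\<lambda>h. 1 / Cf\<^sup>2 * (fst z \<bullet> fst h)
    + 1 / (2 * ln (real CARD('m))) * (\<Sum>i\<in>UNIV. (ln (snd z $ i) + 1) * snd h $ i))) (at z)"
proof -
  have nth: "((\<lambda>p. snd p $ i) has_derivative (\<lambda>h. snd h $ i)) (at z)"
    for i :: 'm and z :: "(real^'n) \<times> (real^'m)"
    by (intro bounded_linear_imp_has_derivative bounded_linear_compose[OF bounded_linear_vec_nth]
        bounded_linear_snd)
  show ?thesis
    unfolding omega_def case_prod_beta power2_norm_eq_inner
    by (rule derivative_eq_intros nth refl assms)+
      (use assms in \<open>auto simp: fun_eq_iff inner_commute field_simps less_imp_neq[symmetric] intro!: sum.cong\<close>)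
qed

text \<open>The closed form is a scaled squared distance plus a scaled Kullback-Leibler divergence.
  The entropy gradient has a constant 1 in every coordinate, which cancels because both weight
  vectors have total mass one.\<close>

lemma bregman_omega:
  fixes z u :: "(real^'n) \<times> (real^'m::finite)"
  assumes z: "z \<in> positive_feasible Cf" and u: "u \<in> feasible Cf"
  shows "bregman (omega Cf) z u = bregman_omega Cf z u"
proof -
  have pos: "\<And>i. 0 < snd z $ i" and s1: "(\<Sum>i\<in>UNIV. snd z $ i) = 1" "(\<Sum>i\<in>UNIV. snd u $ i) = 1"
    using z u by (auto simp: positive_feasible_def feasible_def prob_simplex_def)
  define c where "c = 1 / (2 * ln (real CARD('m)))"
  have "frechet_derivative (omega Cf) (at z) = (\<lambda>h. 1 / Cf\<^sup>2 * (fst z \<bullet> fst h)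
      + c * (\<Sum>i\<in>UNIV. (ln (snd z $ i) + 1) * snd h $ i))"
    unfolding c_def using frechet_derivative_at[OF has_derivative_omega[OF pos]] by (rule sym)
  then have "bregman (omega Cf) z u = 1 / (2 * Cf\<^sup>2) * ((norm (fst u))\<^sup>2 - (norm (fst z))\<^sup>2 - 2 * (fst z \<bullet> (fst u - fst z)))
      + c * ((\<Sum>i\<in>UNIV. snd u $ i * ln (snd u $ i)) - (\<Sum>i\<in>UNIV. snd z $ i * ln (snd z $ i))
         - (\<Sum>i\<in>UNIV. (ln (snd z $ i) + 1) * (snd u $ i - snd z $ i)))"
    by (simp add: bregman_def omega_def case_prod_beta c_def[symmetric] right_diff_distrib diff_divide_distrib)
  also have "(norm (fst u))\<^sup>2 - (norm (fst z))\<^sup>2 - 2 * (fst z \<bullet> (fst u - fst z)) = (norm (fst u - fst z))\<^sup>2"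
    by (simp add: power2_norm_eq_inner inner_diff inner_commute)
  also have "(\<Sum>i\<in>UNIV. snd u $ i * ln (snd u $ i)) - (\<Sum>i\<in>UNIV. snd z $ i * ln (snd z $ i))
         - (\<Sum>i\<in>UNIV. (ln (snd z $ i) + 1) * (snd u $ i - snd z $ i))
     = (\<Sum>i\<in>UNIV. snd u $ i * (ln (snd u $ i) - ln (snd z $ i))) - ((\<Sum>i\<in>UNIV. snd u $ i) - (\<Sum>i\<in>UNIV. snd z $ i))"
    by (simp add: sum_subtractf[symmetric] algebra_simps)
  finally show ?thesis
    by (simp add: bregman_omega_def c_def s1)
qed

text \<open>For \<open>s = a\<^sup>2\<close> and \<open>t = b\<^sup>2\<close>, the bound
  \<open>ln (a / b) \<le> a / b - 1\<close> yields the Hellinger term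
  \<open>(b - a)\<^sup>2\<close>, and \<open>a + b \<le> 2\<close> costs the factor 4. The linear
  terms cancel when summed over two points of the simplex.\<close>

lemma entropy_scalar_ge:
  fixes s t :: real
  assumes "0 < s" "s \<le> 1" "0 \<le> t" "t \<le> 1"
  shows "t * (ln t - ln s) - t + s \<ge> (t - s)\<^sup>2 / 4"
proof (cases "t = 0")
  case True
  have "s * s \<le> s * 1" by (rule mult_left_mono) (use assms in auto)
  then show ?thesis using True assms by (simp add: power2_eq_square)
next
  case False
  define a b where "a = sqrt s" and "b = sqrt t"
  have ab: "0 < a" "0 < b" "a \<le> 1" "b \<le> 1" "s = a\<^sup>2" "t = b\<^sup>2"
    using assms False by (auto simp: a_def b_def)
  have "ln (a / b) \<le> a / b - 1"
    using ab by (intro ln_le_minus_one) auto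
  then have "ln a - ln b \<le> a / b - 1"
    using ab by (simp add: ln_div)
  then have "b\<^sup>2 * (ln a - ln b) \<le> b\<^sup>2 * (a / b - 1)"
    by (intro mult_left_mono) auto
  moreover have "b\<^sup>2 * (a / b - 1) = a * b - b\<^sup>2"
    using ab by (simp add: field_simps power2_eq_square)
  moreover have "ln s = 2 * ln a" "ln t = 2 * ln b"
    using ab ln_realpow[of a 2] ln_realpow[of b 2] by simp_all
  ultimately have "t * (ln t - ln s) - t + s \<ge> (b - a)\<^sup>2"
    using ab by (simp add: algebra_simps power2_eq_square)
  moreover have "(t - s)\<^sup>2 = (b - a)\<^sup>2 * (a + b)\<^sup>2"
    using ab by (simp add: power2_eq_square algebra_simps)
  moreover have "(b - a)\<^sup>2 * (a + b)\<^sup>2 \<le> (b - a)\<^sup>2 * 2\<^sup>2"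
    using ab by (intro mult_left_mono power_mono) auto
  ultimately show ?thesis by simp
qed

lemma prob_simplex_le_1:
  assumes "l \<in> prob_simplex" shows "l $ i \<le> 1"
  using assms member_le_sum[of i UNIV "($) l"] by (auto simp: prob_simplex_def)

text \<open>A strong convexity modulus of \<open>omega\<close> in the Euclidean norm. The second
  entry is twice the product of the entropy weight \<open>1 / (2 * ln m)\<close> and the 1/4 of
  \<open>entropy_scalar_ge\<close>.\<close>

definition omega_modulus :: "nat \<Rightarrow> real \<Rightarrow> real" where
  "omega_modulus m Cf = min (1 / Cf\<^sup>2) (1 / (4 * ln (real m)))"

lemma omega_modulus_pos: "2 \<le> m \<Longrightarrow> 0 < Cf \<Longrightarrow> 0 < omega_modulus m Cf"
  by (simp add: omega_modulus_def)

lemma norm_prod_sq: "(norm (z :: 'a::real_inner \<times> 'b::real_inner))\<^sup>2 = (norm (fst z))\<^sup>2 + (norm (snd z))\<^sup>2"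
  by (simp add: power2_norm_eq_inner inner_prod_def)

text \<open>A Pinsker-type bound, obtained coordinatewise from \<open>entropy_scalar_ge\<close>; it
  supplies the quadratic term that mirror descent needs.\<close>

lemma bregman_omega_ge:
  fixes z u :: "(real^'n) \<times> (real^'m::finite)"
  assumes m: "2 \<le> CARD('m)" and z: "z \<in> positive_feasible Cf" and u: "u \<in> feasible Cf"
  shows "omega_modulus CARD('m) Cf / 2 * (norm (u - z))\<^sup>2 \<le> bregman_omega Cf z u"
proof -
  have pos: "\<And>i. 0 < snd z $ i" and s1: "(\<Sum>i\<in>UNIV. snd z $ i) = 1" "(\<Sum>i\<in>UNIV. snd u $ i) = 1"
    and sx: "snd z \<in> prob_simplex" "snd u \<in> prob_simplex"
    using z u by (auto simp: positive_feasible_def feasible_def prob_simplex_def)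
  let ?\<kappa> = "omega_modulus CARD('m) Cf"
  have "(norm (snd u - snd z))\<^sup>2 / 4 = (\<Sum>i\<in>UNIV. (snd u $ i - snd z $ i)\<^sup>2 / 4)"
    unfolding power2_norm_eq_inner inner_vec_def by (simp add: power2_eq_square flip: sum_divide_distrib)
  also have "\<dots> \<le> (\<Sum>i\<in>UNIV. snd u $ i * (ln (snd u $ i) - ln (snd z $ i)) - snd u $ i + snd z $ i)"
    using pos sx prob_simplex_le_1 by (intro sum_mono entropy_scalar_ge) (auto simp: prob_simplex_def)
  also have "\<dots> = (\<Sum>i\<in>UNIV. snd u $ i * (ln (snd u $ i) - ln (snd z $ i)))"
    by (simp add: sum.distrib sum_subtractf s1)
  finally have K: "(norm (snd u - snd z))\<^sup>2 / 4 \<le> \<dots>" .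
  have "?\<kappa> / 2 * (norm (snd u - snd z))\<^sup>2 \<le> (1 / (4 * ln (real CARD('m)))) / 2 * (norm (snd u - snd z))\<^sup>2"
    by (intro mult_right_mono divide_right_mono) (auto simp: omega_modulus_def)
  also have "\<dots> = 1 / (2 * ln (real CARD('m))) * ((norm (snd u - snd z))\<^sup>2 / 4)" by simp
  also have "\<dots> \<le> 1 / (2 * ln (real CARD('m))) * (\<Sum>i\<in>UNIV. snd u $ i * (ln (snd u $ i) - ln (snd z $ i)))"
    using m K by (intro mult_left_mono) auto
  finally have A: "?\<kappa> / 2 * (norm (snd u - snd z))\<^sup>2 \<le> \<dots>" .
  have "?\<kappa> / 2 * (norm (fst u - fst z))\<^sup>2 \<le> (1 / Cf\<^sup>2) / 2 * (norm (fst u - fst z))\<^sup>2"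
    by (intro mult_right_mono divide_right_mono) (auto simp: omega_modulus_def)
  then have B: "?\<kappa> / 2 * (norm (fst u - fst z))\<^sup>2 \<le> (norm (fst u - fst z))\<^sup>2 / (2 * Cf\<^sup>2)"
    by (simp add: field_simps)
  show ?thesis
    using A B unfolding bregman_omega_def norm_prod_sq[of "u - z"]
    by (simp add: distrib_left del: times_divide_eq_left times_divide_eq_right)
qed

text \<open>The candidate for the prox step: projected gradient on the ball, multiplicative weights
  on the simplex. The rates \<open>Cf\<^sup>2\<close> and \<open>2 * ln m\<close> are the inverse
  weights of the two parts of \<open>omega\<close>.\<close>

definition omega_step :: "real \<Rightarrow> (real^'n) \<times> (real^'m::finite) \<Rightarrow> (real^'n) \<times> (real^'m) \<Rightarrow> (real^'n) \<times> (real^'m)" where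
  "omega_step Cf z \<zeta> = (closest_point (cball 0 Cf) (fst z - Cf\<^sup>2 *\<^sub>R fst \<zeta>),
     \<chi> i. snd z $ i * exp (- 2 * ln (real CARD('m)) * snd \<zeta> $ i)
       / (\<Sum>j\<in>UNIV. snd z $ j * exp (- 2 * ln (real CARD('m)) * snd \<zeta> $ j)))"

lemma omega_step_feasible:
  fixes z \<zeta> :: "(real^'n) \<times> (real^'m::finite)"
  assumes Cf: "0 < Cf" and z: "z \<in> positive_feasible Cf"
  shows "omega_step Cf z \<zeta> \<in> positive_feasible Cf"
proof -
  have pos: "\<And>i. 0 < snd z $ i"
    using z by (auto simp: positive_feasible_def)
  have cp: "closest_point (cball 0 Cf) x \<in> cball 0 Cf" for x :: "real^'n"
    using Cf by (intro closest_point_in_set) auto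
  have W: "0 < (\<Sum>j\<in>UNIV. snd z $ j * exp (- 2 * ln (real CARD('m)) * snd \<zeta> $ j))"
    using pos by (intro sum_pos) auto
  show ?thesis
    using cp pos W
    by (auto simp: omega_step_def positive_feasible_def feasible_def prob_simplex_def
        sum_divide_distrib[symmetric] simp del: mem_cball intro!: divide_pos_pos divide_nonneg_pos less_imp_le)
qed

text \<open>The two factors separate. The entropy part holds with equality, since its minimiser has
  positive weights; the ball part is the obtuse-angle property of the projection.\<close>

lemma omega_step_three_point:
  fixes z u \<zeta> :: "(real^'n) \<times> (real^'m::finite)"
  assumes m: "2 \<le> CARD('m)" and Cf: "0 < Cf" and z: "z \<in> positive_feasible Cf" and u: "u \<in> feasible Cf"
  shows "\<zeta> \<bullet> (omega_step Cf z \<zeta> - z) + bregman_omega Cf z (omega_step Cf z \<zeta>)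
      + bregman_omega Cf (omega_step Cf z \<zeta>) u \<le> \<zeta> \<bullet> (u - z) + bregman_omega Cf z u"
proof -
  define p where "p = omega_step Cf z \<zeta>"
  define c where "c = 1 / (2 * ln (real CARD('m)))"
  define W where "W = (\<Sum>j\<in>UNIV. snd z $ j * exp (- 2 * ln (real CARD('m)) * snd \<zeta> $ j))"
  have c: "0 < c" using m by (simp add: c_def)
  have pos: "\<And>i. 0 < snd z $ i"
    using z by (auto simp: positive_feasible_def)
  have W: "0 < W"
    unfolding W_def using pos by (intro sum_pos) auto
  have pf: "p \<in> feasible Cf"
    using omega_step_feasible[OF Cf z] by (auto simp: p_def positive_feasible_def)
  \<comment> \<open>First-order condition on the simplex: the value is the same for all
    \<open>i\<close>, and the normaliser \<open>W\<close> determines the multiplier.\<close>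
  have "snd \<zeta> $ i + c * (ln (snd p $ i) - ln (snd z $ i)) = - c * ln W" for i
  proof -
    have "snd p $ i = snd z $ i * exp (- 2 * ln (real CARD('m)) * snd \<zeta> $ i) / W"
      by (simp add: p_def omega_step_def W_def)
    then have "ln (snd p $ i) = ln (snd z $ i) - 2 * ln (real CARD('m)) * snd \<zeta> $ i - ln W"
      using pos[of i] W by (simp add: ln_div ln_mult less_imp_neq[symmetric])
    then have "ln (snd p $ i) - ln (snd z $ i) = - (2 * ln (real CARD('m))) * snd \<zeta> $ i - ln W"
      by simp
    then have "c * (ln (snd p $ i) - ln (snd z $ i)) = - (c * (2 * ln (real CARD('m)))) * snd \<zeta> $ i - c * ln W"
      by (simp only:) (simp add: algebra_simps)
    moreover have "c * (2 * ln (real CARD('m))) = 1"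
      using m by (simp add: c_def)
    ultimately show ?thesis
      by simp
  qed
  then have *: "snd \<zeta> $ i = - c * ln W - c * (ln (snd p $ i) - ln (snd z $ i))" for i
    by (simp add: algebra_simps)
  \<comment> \<open>Up to a constant, the entropic prox objective at \<open>q\<close> is the
    divergence of \<open>q\<close> from \<open>p\<close>. It is used at \<open>u\<close> and at
    \<open>p\<close> itself, where this divergence vanishes.\<close>
  have ent: "(\<Sum>i\<in>UNIV. snd \<zeta> $ i * snd q $ i) + c * (\<Sum>i\<in>UNIV. snd q $ i * (ln (snd q $ i) - ln (snd z $ i)))
      = c * (\<Sum>i\<in>UNIV. snd q $ i * (ln (snd q $ i) - ln (snd p $ i))) - c * ln W"
    if "q \<in> feasible Cf" for q :: "(real^'n) \<times> (real^'m)"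
  proof -
    have s: "(\<Sum>i\<in>UNIV. snd q $ i) = 1" using that by (auto simp: feasible_def prob_simplex_def)
    have "(\<Sum>i\<in>UNIV. snd \<zeta> $ i * snd q $ i) + c * (\<Sum>i\<in>UNIV. snd q $ i * (ln (snd q $ i) - ln (snd z $ i)))
      = (\<Sum>i\<in>UNIV. c * (snd q $ i * (ln (snd q $ i) - ln (snd p $ i))) - c * ln W * snd q $ i)"
      unfolding sum_distrib_left sum.distrib[symmetric] * by (rule sum.cong) (auto simp: algebra_simps)
    also have "\<dots> = c * (\<Sum>i\<in>UNIV. snd q $ i * (ln (snd q $ i) - ln (snd p $ i))) - c * ln W"
      by (simp add: sum_subtractf sum_distrib_left[symmetric] s)
    finally show ?thesis .
  qed
  have E: "(\<Sum>i\<in>UNIV. snd \<zeta> $ i * snd p $ i) + c * (\<Sum>i\<in>UNIV. snd p $ i * (ln (snd p $ i) - ln (snd z $ i)))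
      + c * (\<Sum>i\<in>UNIV. snd u $ i * (ln (snd u $ i) - ln (snd p $ i)))
    = (\<Sum>i\<in>UNIV. snd \<zeta> $ i * snd u $ i) + c * (\<Sum>i\<in>UNIV. snd u $ i * (ln (snd u $ i) - ln (snd z $ i)))"
    using ent[OF u] ent[OF pf] by simp
  define y where "y = fst z - Cf\<^sup>2 *\<^sub>R fst \<zeta>"
  have fp: "fst p = closest_point (cball 0 Cf) y"
    by (simp add: p_def omega_step_def y_def)
  have "(y - fst p) \<bullet> (fst u - fst p) \<le> 0"
    unfolding fp using u by (intro closest_point_dot) (auto simp: feasible_def)
  then have "2 * ((fst z - fst p) \<bullet> (fst u - fst p)) \<le> 2 * Cf\<^sup>2 * (fst \<zeta> \<bullet> (fst u - fst p))"
    by (simp add: y_def inner_diff_left)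
  moreover have "(norm (fst p - fst z))\<^sup>2 + (norm (fst u - fst p))\<^sup>2 = (norm (fst u - fst z))\<^sup>2
     + 2 * ((fst z - fst p) \<bullet> (fst u - fst p))"
    by (simp add: power2_norm_eq_inner inner_diff inner_commute)
  ultimately have "(norm (fst p - fst z))\<^sup>2 + (norm (fst u - fst p))\<^sup>2
      \<le> (norm (fst u - fst z))\<^sup>2 + 2 * Cf\<^sup>2 * (fst \<zeta> \<bullet> (fst u - fst p))"
    by linarith
  then have "((norm (fst p - fst z))\<^sup>2 + (norm (fst u - fst p))\<^sup>2) / (2 * Cf\<^sup>2)
      \<le> ((norm (fst u - fst z))\<^sup>2 + 2 * Cf\<^sup>2 * (fst \<zeta> \<bullet> (fst u - fst p))) / (2 * Cf\<^sup>2)"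
    by (rule divide_right_mono) simp
  then have Q: "(norm (fst p - fst z))\<^sup>2 / (2 * Cf\<^sup>2) + (norm (fst u - fst p))\<^sup>2 / (2 * Cf\<^sup>2)
      \<le> (norm (fst u - fst z))\<^sup>2 / (2 * Cf\<^sup>2) + fst \<zeta> \<bullet> (fst u - fst p)"
    using Cf by (simp add: add_divide_distrib)
  have I: "\<zeta> \<bullet> (q - z) = fst \<zeta> \<bullet> fst q + (\<Sum>i\<in>UNIV. snd \<zeta> $ i * snd q $ i) - \<zeta> \<bullet> z" for q
    by (simp add: inner_prod_def inner_diff_right inner_vec_def[of "snd \<zeta>" "snd q"])
  show ?thesis
    unfolding p_def[symmetric] bregman_omega_def c_def[symmetric] I
    using Q E by (simp add: inner_diff_right)
qed

text \<open>The three-point inequality together with \<open>bregman_omega_ge\<close> gives quadratic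
  growth of the objective around \<open>omega_step\<close>. Hence the minimiser is unique and the
  choice in \<open>arg_min_on\<close> is determined.\<close>

lemma prox_omega:
  fixes z \<zeta> :: "(real^'n) \<times> (real^'m::finite)"
  assumes m: "2 \<le> CARD('m)" and Cf: "0 < Cf" and z: "z \<in> positive_feasible Cf"
  shows "prox (omega Cf) (feasible Cf) z \<zeta> = omega_step Cf z \<zeta>"
proof -
  define p where "p = omega_step Cf z \<zeta>"
  define J where "J u = \<zeta> \<bullet> (u - z) + bregman (omega Cf) z u" for u
  have p: "p \<in> positive_feasible Cf" "p \<in> feasible Cf"
    using omega_step_feasible[OF Cf z] by (auto simp: p_def positive_feasible_def)
  have J: "J p + omega_modulus CARD('m) Cf / 2 * (norm (u - p))\<^sup>2 \<le> J u" if u: "u \<in> feasible Cf" for u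
    using omega_step_three_point[OF m Cf z u, of \<zeta>] bregman_omega_ge[OF m p(1) u]
    by (simp add: J_def bregman_omega[OF z u] bregman_omega[OF z p(2)] p_def[symmetric])
  have \<kappa>: "0 < omega_modulus CARD('m) Cf" using m Cf by (rule omega_modulus_pos)
  have le: "J p \<le> J u" if "u \<in> feasible Cf" for u
  proof -
    have "0 \<le> omega_modulus CARD('m) Cf / 2 * (norm (u - p))\<^sup>2" using \<kappa> by simp
    then show ?thesis using J[OF that] by linarith
  qed
  have "arg_min_on J (feasible Cf) = p"
    unfolding arg_min_on_def arg_min_def
  proof (rule some_equality)
    show "is_arg_min J (\<lambda>x. x \<in> feasible Cf) p"
      using p(2) le by (auto simp: is_arg_min_linorder)
    fix u assume "is_arg_min J (\<lambda>x. x \<in> feasible Cf) u"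
    then have "u \<in> feasible Cf" "J u \<le> J p" using p by (simp_all add: is_arg_min_linorder del: split_paired_All)
    with J[of u] have "omega_modulus CARD('m) Cf / 2 * (norm (u - p))\<^sup>2 \<le> 0" by simp
    then show "u = p" using \<kappa> by (simp add: mult_le_0_iff)
  qed
  then show ?thesis by (simp add: prox_def J_def[abs_def] p_def)
qed

lemma inner_iter_positive_feasible:
  fixes G :: "'m::finite \<Rightarrow> real^'n \<Rightarrow> 'x \<Rightarrow> real^'n"
  assumes m: "2 \<le> CARD('m)" and Cf: "0 < Cf"
  shows "inner_iter Cf G \<gamma> x X s \<in> positive_feasible Cf"
proof (induction s)
  case 0
  show ?case using m Cf by (simp add: positive_feasible_def feasible_def prob_simplex_def)
next
  case (Suc s)
  then show ?case by (simp add: prox_omega[OF m Cf] omega_step_feasible[OF Cf])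
qed

text \<open>One step of mirror descent: Young's inequality absorbs the movement from
  \<open>z\<close> to the new point into the strong convexity term left by the three-point
  inequality.\<close>

lemma omega_step_descent:
  fixes z u \<zeta> :: "(real^'n) \<times> (real^'m::finite)"
  assumes m: "2 \<le> CARD('m)" and Cf: "0 < Cf" and z: "z \<in> positive_feasible Cf" and u: "u \<in> feasible Cf"
  shows "\<gamma> * (\<zeta> \<bullet> (z - u)) \<le> bregman_omega Cf z u - bregman_omega Cf (omega_step Cf z (\<gamma> *\<^sub>R \<zeta>)) u
      + \<gamma>\<^sup>2 * (norm \<zeta>)\<^sup>2 / (2 * omega_modulus CARD('m) Cf)"
proof -
  define p where "p = omega_step Cf z (\<gamma> *\<^sub>R \<zeta>)"
  let ?\<kappa> = "omega_modulus CARD('m) Cf"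
  have \<kappa>: "0 < ?\<kappa>" using m Cf by (rule omega_modulus_pos)
  have p: "p \<in> feasible Cf"
    using omega_step_feasible[OF Cf z] by (auto simp: p_def positive_feasible_def)
  \<comment> \<open>Expanding this square is Young's inequality, with the modulus as weight.\<close>
  have "0 \<le> (norm (?\<kappa> *\<^sub>R (p - z) + \<gamma> *\<^sub>R \<zeta>))\<^sup>2" by simp
  also have "\<dots> = 2 * ?\<kappa> * (?\<kappa> / 2 * (norm (p - z))\<^sup>2 + \<gamma> * (\<zeta> \<bullet> (p - z)) + \<gamma>\<^sup>2 * (norm \<zeta>)\<^sup>2 / (2 * ?\<kappa>))"
    using \<kappa> by (simp only: power2_norm_eq_inner inner_add_left inner_add_right inner_scaleR_left inner_scaleR_right
        inner_commute[of "p - z" \<zeta>]) (simp add: field_simps power2_eq_square)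
  finally have "0 \<le> ?\<kappa> / 2 * (norm (p - z))\<^sup>2 + \<gamma> * (\<zeta> \<bullet> (p - z)) + \<gamma>\<^sup>2 * (norm \<zeta>)\<^sup>2 / (2 * ?\<kappa>)"
    using \<kappa> by (simp add: zero_le_mult_iff)
  moreover have "\<gamma> * (\<zeta> \<bullet> (p - z)) + bregman_omega Cf z p + bregman_omega Cf p u \<le> \<gamma> * (\<zeta> \<bullet> (u - z)) + bregman_omega Cf z u"
    using omega_step_three_point[OF m Cf z u, of "\<gamma> *\<^sub>R \<zeta>"] by (simp add: p_def)
  moreover have "?\<kappa> / 2 * (norm (p - z))\<^sup>2 \<le> bregman_omega Cf z p"
    by (rule bregman_omega_ge[OF m z p])
  moreover have "\<gamma> * (\<zeta> \<bullet> (u - z)) = - (\<gamma> * (\<zeta> \<bullet> (z - u)))"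
    by (simp add: inner_diff_right algebra_simps)
  ultimately show ?thesis unfolding p_def[symmetric] by linarith
qed

text \<open>Relative entropy with respect to the uniform weights is at most \<open>ln m\<close>, and
  the squared distance from 0 is at most \<open>Cf\<^sup>2\<close>; the normalisation of
  \<open>omega\<close> turns each into 1/2.\<close>

lemma bregman_omega_init_le:
  fixes u :: "(real^'n) \<times> (real^'m::finite)"
  assumes m: "2 \<le> CARD('m)" and Cf: "0 < Cf" and u: "u \<in> feasible Cf"
  shows "bregman_omega Cf (0, \<chi> i. 1 / real CARD('m)) u \<le> 1"
proof -
  have sx: "\<And>i. 0 \<le> snd u $ i" "(\<Sum>i\<in>UNIV. snd u $ i) = 1" "snd u \<in> prob_simplex"
    and d: "norm (fst u) \<le> Cf"
    using u by (auto simp: feasible_def prob_simplex_def)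
  have "(\<Sum>i\<in>UNIV. snd u $ i * (ln (snd u $ i) - ln (1 / real CARD('m)))) \<le> (\<Sum>i\<in>UNIV. snd u $ i * ln (real CARD('m)))"
  proof (intro sum_mono)
    fix i
    have "snd u $ i * ln (snd u $ i) \<le> 0"
      using sx(1)[of i] prob_simplex_le_1[OF sx(3), of i]
      by (cases "snd u $ i = 0") (auto intro: mult_nonneg_nonpos simp: less_le)
    then show "snd u $ i * (ln (snd u $ i) - ln (1 / real CARD('m))) \<le> snd u $ i * ln (real CARD('m))"
      by (simp add: ln_div algebra_simps)
  qed
  also have "\<dots> = ln (real CARD('m))" by (simp add: sum_distrib_right[symmetric] sx)
  finally have "1 / (2 * ln (real CARD('m))) * (\<Sum>i\<in>UNIV. snd u $ i * (ln (snd u $ i) - ln (1 / real CARD('m))))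
     \<le> 1 / (2 * ln (real CARD('m))) * ln (real CARD('m))"
    using m by (intro mult_left_mono) auto
  also have "\<dots> = 1 / 2" using m by simp
  finally have "1 / (2 * ln (real CARD('m))) * (\<Sum>i\<in>UNIV. snd u $ i * (ln (snd u $ i) - ln (1 / real CARD('m)))) \<le> 1 / 2" .
  moreover have "(norm (fst u))\<^sup>2 / (2 * Cf\<^sup>2) \<le> Cf\<^sup>2 / (2 * Cf\<^sup>2)"
    using d by (intro divide_right_mono power_mono) auto
  moreover have "Cf\<^sup>2 / (2 * Cf\<^sup>2) = 1 / 2" using Cf by simp
  ultimately show ?thesis unfolding bregman_omega_def fst_conv snd_conv vec_lambda_beta diff_0_right by linarith
qed

text \<open>A pathwise statement, valid for every sample sequence. The one-step inequalities
  telescope, and the last divergence is dropped because it is nonnegative.\<close>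

lemma inner_iter_regret:
  fixes G :: "'m::finite \<Rightarrow> real^'n \<Rightarrow> 'x \<Rightarrow> real^'n" and u :: "(real^'n) \<times> (real^'m)"
    and \<gamma> :: real and x :: "real^'n" and X :: "nat \<Rightarrow> 'x"
  assumes m: "2 \<le> CARD('m)" and Cf: "0 < Cf" and u: "u \<in> feasible Cf"
  defines "z \<equiv> inner_iter Cf G (\<lambda>_. \<gamma>) x X"
    and "\<zeta> \<equiv> \<lambda>s. sub_grad (\<lambda>i. G i x (X s)) (inner_iter Cf G (\<lambda>_. \<gamma>) x X s)"
  shows "\<gamma> * (\<Sum>s<N. \<zeta> s \<bullet> (z s - u)) \<le> 1 + \<gamma>\<^sup>2 / (2 * omega_modulus CARD('m) Cf) * (\<Sum>s<N. (norm (\<zeta> s))\<^sup>2)"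
proof -
  let ?\<kappa> = "omega_modulus CARD('m) Cf"
  have z: "z s \<in> positive_feasible Cf" for s
    unfolding z_def using inner_iter_positive_feasible[OF m Cf] .
  have zS: "z (Suc s) = omega_step Cf (z s) (\<gamma> *\<^sub>R \<zeta> s)" for s
    using z by (simp add: z_def \<zeta>_def prox_omega[OF m Cf])
  have "(\<Sum>s<N. \<gamma> * (\<zeta> s \<bullet> (z s - u)))
      \<le> (\<Sum>s<N. bregman_omega Cf (z s) u - bregman_omega Cf (z (Suc s)) u + \<gamma>\<^sup>2 * (norm (\<zeta> s))\<^sup>2 / (2 * ?\<kappa>))"
    unfolding zS by (intro sum_mono omega_step_descent[OF m Cf z u])
  also have "\<dots> = (\<Sum>s<N. bregman_omega Cf (z s) u - bregman_omega Cf (z (Suc s)) u)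
      + \<gamma>\<^sup>2 / (2 * ?\<kappa>) * (\<Sum>s<N. (norm (\<zeta> s))\<^sup>2)"
    by (simp add: sum.distrib sum_distrib_left)
  also have "(\<Sum>s<N. bregman_omega Cf (z s) u - bregman_omega Cf (z (Suc s)) u)
      = bregman_omega Cf (z 0) u - bregman_omega Cf (z N) u"
    by (rule sum_lessThan_telescope')
  finally have "(\<Sum>s<N. \<gamma> * (\<zeta> s \<bullet> (z s - u))) \<le> bregman_omega Cf (z 0) u - bregman_omega Cf (z N) u
      + \<gamma>\<^sup>2 / (2 * ?\<kappa>) * (\<Sum>s<N. (norm (\<zeta> s))\<^sup>2)" .
  moreover have "bregman_omega Cf (z 0) u \<le> 1"
    using bregman_omega_init_le[OF m Cf u] by (simp add: z_def)
  moreover have "0 \<le> bregman_omega Cf (z N) u"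
    using bregman_omega_ge[OF m z u, of N] omega_modulus_pos[OF m Cf]
    by (meson dual_order.trans less_imp_le mult_nonneg_nonneg half_gt_zero zero_le_power2)
  ultimately show ?thesis by (simp add: sum_distrib_left)
qed

section \<open>The steepest common descent direction\<close>

lemma convex_prob_simplex: "convex (prob_simplex :: (real^'m::finite) set)"
  by (auto simp: convex_def prob_simplex_def sum.distrib sum_distrib_left[symmetric])

lemma compact_prob_simplex: "compact (prob_simplex :: (real^'m::finite) set)"
proof -
  have "norm l \<le> 1" if l: "l \<in> prob_simplex" for l :: "real^'m"
    using norm_le_l1_cart[of l] l by (simp add: prob_simplex_def)
  then have "bounded (prob_simplex :: (real^'m) set)"
    by (auto simp: bounded_iff)
  moreover have "closed (prob_simplex :: (real^'m) set)"
    unfolding prob_simplex_def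
    by (intro closed_Collect_conj closed_Collect_all closed_Collect_le closed_Collect_eq continuous_intros)
  ultimately show ?thesis by (simp add: compact_eq_bounded_closed)
qed

lemma norm_simplex_combination_le:
  assumes "l \<in> prob_simplex" "\<And>i. norm (v i) \<le> B"
  shows "norm (\<Sum>i\<in>UNIV. l $ i *\<^sub>R v i) \<le> B"
proof -
  have "norm (\<Sum>i\<in>UNIV. l $ i *\<^sub>R v i) \<le> (\<Sum>i\<in>UNIV. l $ i * B)"
    using assms by (intro order.trans[OF norm_sum] sum_mono) (auto simp: prob_simplex_def intro!: mult_left_mono)
  also have "\<dots> = B" using assms by (simp add: prob_simplex_def sum_distrib_right[symmetric])
  finally show ?thesis .
qed

text \<open>The steepest common descent direction is minus the point of least norm in the convex hull
  of the gradients; the optimality conditions at that point give the dual multipliers.\<close>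

lemma common_descent_dual:
  fixes v :: "'m::finite \<Rightarrow> real^'n"
  obtains l where "l \<in> prob_simplex" "common_descent v = - (\<Sum>i\<in>UNIV. l $ i *\<^sub>R v i)"
    "\<And>i. v i \<bullet> common_descent v \<le> - (norm (common_descent v))\<^sup>2"
proof -
  define T where "T l = (\<Sum>i\<in>UNIV. l $ i *\<^sub>R v i)" for l :: "real^'m"
  have lin: "linear T"
    unfolding T_def by (intro linearI) (simp_all add: sum.distrib algebra_simps scaleR_sum_right)
  define H where "H = T ` prob_simplex"
  have H: "convex H" "closed H"
    unfolding H_def
    by (auto intro!: convex_linear_image lin convex_prob_simplex compact_imp_closed compact_continuous_image
        compact_prob_simplex linear_continuous_on linear_conv_bounded_linear[THEN iffD1])
  have ax: "axis i 1 \<in> (prob_simplex :: (real^'m) set)" for i :: 'm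
    by (auto simp: prob_simplex_def axis_def)
  have Hv: "v i \<in> H" for i
  proof -
    have "T (axis i 1) = v i"
      by (simp add: T_def axis_def if_distrib[of "\<lambda>a. a *\<^sub>R _"] cong: if_cong)
    then show ?thesis using ax[of i] unfolding H_def by (metis image_eqI)
  qed
  define p where "p = closest_point H 0"
  have "p \<in> H" unfolding p_def using H Hv by (intro closest_point_in_set) auto
  then obtain l where l: "l \<in> prob_simplex" "p = T l" by (auto simp: H_def)
  \<comment> \<open>The projection inequality for the point 0, tested against the hull point
    \<open>v i\<close>.\<close>
  have dot: "v i \<bullet> (- p) \<le> - (norm p)\<^sup>2" for i
    using closest_point_dot[OF H Hv, of 0 i]
    by (simp add: p_def[symmetric] power2_norm_eq_inner inner_diff inner_commute)
  define J where "J d = (MAX i. v i \<bullet> d) + (norm d)\<^sup>2 / 2" for d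
  \<comment> \<open>The maximum dominates the average with weights \<open>l\<close>; completing the
    square then leaves \<open>- p\<close> as the only possible minimiser.\<close>
  have lo: "J d \<ge> - (norm p)\<^sup>2 / 2 + (norm (d + p))\<^sup>2 / 2" for d
  proof -
    have "p \<bullet> d = (\<Sum>i\<in>UNIV. l $ i * (v i \<bullet> d))"
      by (simp add: l(2) T_def inner_sum_left)
    also have "\<dots> \<le> (\<Sum>i\<in>UNIV. l $ i * (MAX i. v i \<bullet> d))"
      using l(1) by (intro sum_mono mult_left_mono) (auto simp: prob_simplex_def)
    also have "\<dots> = (MAX i. v i \<bullet> d)"
      using l(1) by (simp add: prob_simplex_def sum_distrib_right[symmetric])
    finally show ?thesis
      by (simp add: J_def power2_norm_eq_inner inner_add inner_commute field_simps)
  qed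
  have "(MAX i. v i \<bullet> (- p)) \<le> - (norm p)\<^sup>2"
    by (rule Max.boundedI) (use dot in auto)
  then have up: "J (- p) \<le> - (norm p)\<^sup>2 / 2"
    unfolding J_def norm_minus_cancel by linarith
  have "common_descent v = - p"
    unfolding common_descent_def arg_min_def J_def[symmetric, abs_def]
  proof (rule some_equality)
    show "is_arg_min J (\<lambda>_. True) (- p)"
      unfolding is_arg_min_linorder
    proof (intro conjI allI impI TrueI)
      fix y
      have "0 \<le> (norm (y + p))\<^sup>2 / 2" by simp
      with lo[of y] up show "J (- p) \<le> J y" by linarith
    qed
    fix d assume "is_arg_min J (\<lambda>_. True) d"
    then have "J d \<le> J (- p)" by (auto simp: is_arg_min_linorder)
    with lo[of d] up have "(norm (d + p))\<^sup>2 / 2 \<le> 0" by linarith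
    then show "d = - p" by (simp add: add_eq_0_iff2)
  qed
  then show ?thesis using that l dot by (simp add: T_def)
qed

text \<open>The minimal-norm property of the hull point. Pairing the combination with the direction
  gives at least \<open>(norm ?d)\<^sup>2\<close> in absolute value, and Cauchy-Schwarz cancels one
  factor.\<close>

lemma norm_common_descent_le_combination:
  fixes v :: "'m::finite \<Rightarrow> real^'n"
  assumes l: "l \<in> prob_simplex"
  shows "norm (common_descent v) \<le> norm (\<Sum>i\<in>UNIV. l $ i *\<^sub>R v i)"
proof -
  let ?d = "common_descent v"
  obtain l' where dot: "\<And>i. v i \<bullet> ?d \<le> - (norm ?d)\<^sup>2"
    using common_descent_dual[of v] by metis
  have "(\<Sum>i\<in>UNIV. l $ i *\<^sub>R v i) \<bullet> ?d = (\<Sum>i\<in>UNIV. l $ i * (v i \<bullet> ?d))"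
    by (simp add: inner_sum_left)
  also have "\<dots> \<le> (\<Sum>i\<in>UNIV. l $ i * (- (norm ?d)\<^sup>2))"
    using l dot by (intro sum_mono mult_left_mono) (auto simp: prob_simplex_def)
  also have "\<dots> = - (norm ?d)\<^sup>2"
    using l by (simp add: prob_simplex_def sum_distrib_right[symmetric] sum_negf)
  finally have "(norm ?d)\<^sup>2 \<le> \<bar>(\<Sum>i\<in>UNIV. l $ i *\<^sub>R v i) \<bullet> ?d\<bar>" by linarith
  also have "\<dots> \<le> norm (\<Sum>i\<in>UNIV. l $ i *\<^sub>R v i) * norm ?d" by (rule Cauchy_Schwarz_ineq2)
  finally show ?thesis
    by (cases "?d = 0") (simp_all add: power2_eq_square)
qed

lemma norm_common_descent_le:
  fixes v :: "'m::finite \<Rightarrow> real^'n"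
  assumes "\<And>i. norm (v i) \<le> B"
  shows "norm (common_descent v) \<le> B"
proof -
  obtain l where l: "l \<in> prob_simplex" "common_descent v = - (\<Sum>i\<in>UNIV. l $ i *\<^sub>R v i)"
    using common_descent_dual[of v] by metis
  then show ?thesis using norm_simplex_combination_le[OF l(1) assms] by simp
qed

text \<open>The multipliers that are optimal for \<open>w\<close> are still admissible for
  \<open>v\<close>, so they give an upper bound there.\<close>

lemma norm_common_descent_diff_le:
  fixes v w :: "'m::finite \<Rightarrow> real^'n"
  assumes "\<And>i. norm (v i - w i) \<le> B"
  shows "norm (common_descent v) \<le> norm (common_descent w) + B"
proof -
  obtain l where l: "l \<in> prob_simplex" "common_descent w = - (\<Sum>i\<in>UNIV. l $ i *\<^sub>R w i)"
    using common_descent_dual[of w] by metis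
  have "norm (common_descent v) \<le> norm (\<Sum>i\<in>UNIV. l $ i *\<^sub>R v i)"
    by (rule norm_common_descent_le_combination[OF l(1)])
  also have "(\<Sum>i\<in>UNIV. l $ i *\<^sub>R v i) = (\<Sum>i\<in>UNIV. l $ i *\<^sub>R w i) + (\<Sum>i\<in>UNIV. l $ i *\<^sub>R (v i - w i))"
    by (simp add: sum.distrib[symmetric] scaleR_diff_right)
  also have "norm \<dots> \<le> norm (common_descent w) + B"
    using norm_simplex_combination_le[OF l(1) assms] l(2)
    by (intro order.trans[OF norm_triangle_ineq] add_mono) simp_all
  finally show ?thesis .
qed

text \<open>Serves the integrability of the squared descent norm along the random iterates.\<close>

lemma continuous_on_norm_common_descent:
  fixes g :: "'m::finite \<Rightarrow> real^'n \<Rightarrow> real^'n"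
  assumes lip: "\<And>i. L-lipschitz_on UNIV (g i)"
  shows "continuous_on UNIV (\<lambda>x. norm (common_descent (\<lambda>i. g i x)))"
proof -
  have le: "norm (common_descent (\<lambda>i. g i x)) \<le> norm (common_descent (\<lambda>i. g i y)) + L * dist x y" for x y
    using lip by (intro norm_common_descent_diff_le) (auto simp: lipschitz_on_def dist_norm)
  have ge: "norm (common_descent (\<lambda>i. g i y)) \<le> norm (common_descent (\<lambda>i. g i x)) + L * dist x y" for x y
    using le[of y x] by (simp add: dist_commute)
  have "0 \<le> L" using lip lipschitz_on_nonneg by blast
  then have "L-lipschitz_on UNIV (\<lambda>x. norm (common_descent (\<lambda>i. g i x)))"
    using le ge by (intro lipschitz_onI) (simp_all add: dist_real_def abs_le_iff diff_le_eq add.commute)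
  then show ?thesis by (rule lipschitz_on_continuous_on)
qed

section \<open>Saddle-point structure and size of the subproblem field\<close>

lemma inner_sub_grad:
  fixes v :: "'m::finite \<Rightarrow> real^'n"
  shows "sub_grad v z \<bullet> u = (\<Sum>i\<in>UNIV. snd z $ i * (v i \<bullet> fst u)) + fst z \<bullet> fst u
    - (\<Sum>i\<in>UNIV. snd u $ i * (v i \<bullet> fst z))"
proof -
  have "(\<chi> i. v i \<bullet> fst z) \<bullet> snd u = (\<Sum>i\<in>UNIV. snd u $ i * (v i \<bullet> fst z))"
    by (simp add: inner_vec_def[of _ "snd u"] mult.commute)
  then show ?thesis
    by (simp add: sub_grad_def case_prod_beta inner_prod_def inner_add_left inner_sum_left)
qed

text \<open>The coupling of \<open>snd z\<close> with \<open>fst z\<close> is skew and cancels.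
  Optimality of \<open>l\<close> evaluates one remaining coupling term exactly, the dual
  inequalities bound the other, and the quadratic part completes the square.\<close>

lemma sub_grad_saddle:
  fixes v :: "'m::finite \<Rightarrow> real^'n"
  assumes l: "l \<in> prob_simplex" "common_descent v = - (\<Sum>i\<in>UNIV. l $ i *\<^sub>R v i)"
    and z: "snd z \<in> prob_simplex"
  shows "(norm (fst z - common_descent v))\<^sup>2 \<le> sub_grad v z \<bullet> (z - (common_descent v, l))"
proof -
  let ?d = "common_descent v"
  obtain l' where dot: "\<And>i. v i \<bullet> ?d \<le> - (norm ?d)\<^sup>2"
    using common_descent_dual[of v] by metis
  have "(\<Sum>i\<in>UNIV. snd z $ i * (v i \<bullet> ?d)) \<le> (\<Sum>i\<in>UNIV. snd z $ i * (- (norm ?d)\<^sup>2))"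
    using z dot by (intro sum_mono mult_left_mono) (auto simp: prob_simplex_def)
  also have "\<dots> = - (norm ?d)\<^sup>2"
    using z by (simp add: prob_simplex_def sum_distrib_right[symmetric] sum_negf)
  finally have 1: "(\<Sum>i\<in>UNIV. snd z $ i * (v i \<bullet> ?d)) \<le> - (norm ?d)\<^sup>2" .
  have 2: "(\<Sum>i\<in>UNIV. l $ i * (v i \<bullet> fst z)) = - (?d \<bullet> fst z)"
    by (simp add: l(2) inner_sum_left)
  have "sub_grad v z \<bullet> (z - (?d, l)) = (\<Sum>i\<in>UNIV. l $ i * (v i \<bullet> fst z)) - (\<Sum>i\<in>UNIV. snd z $ i * (v i \<bullet> ?d))
     + fst z \<bullet> (fst z - ?d)"
    by (simp add: inner_sub_grad inner_diff_right right_diff_distrib left_diff_distrib sum_subtractf)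
  then show ?thesis
    using 1 2 by (simp add: power2_norm_eq_inner inner_diff inner_commute)
qed

text \<open>In this arrangement each \<open>v i\<close> enters once and linearly, so an expectation
  over the sample passes through while \<open>z\<close> and \<open>u\<close> are frozen.\<close>

lemma sub_grad_inner_eq:
  fixes v :: "'m::finite \<Rightarrow> real^'n"
  shows "sub_grad v z \<bullet> u = (\<Sum>i\<in>UNIV. v i \<bullet> (snd z $ i *\<^sub>R fst u - snd u $ i *\<^sub>R fst z)) + fst z \<bullet> fst u"
  by (simp add: inner_sub_grad inner_diff_right sum_subtractf)

text \<open>Stated through the squared norms of the \<open>v i\<close>, because the stochastic
  gradients are controlled only in second moment.\<close>

lemma norm_sub_grad_le:
  fixes v :: "'m::finite \<Rightarrow> real^'n"
  assumes z: "z \<in> feasible Cf"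
  shows "(norm (sub_grad v z))\<^sup>2 \<le> (2 * real CARD('m) + Cf\<^sup>2) * (\<Sum>i\<in>UNIV. (norm (v i))\<^sup>2) + 2 * Cf\<^sup>2"
proof -
  have l: "snd z \<in> prob_simplex" and d: "norm (fst z) \<le> Cf"
    using z by (auto simp: feasible_def)
  have "(norm (\<Sum>i\<in>UNIV. snd z $ i *\<^sub>R v i))\<^sup>2 \<le> (\<Sum>i\<in>UNIV. norm (v i))\<^sup>2"
    by (intro power_mono norm_simplex_combination_le[OF l] member_le_sum) auto
  also have "\<dots> \<le> (\<Sum>i\<in>UNIV. (norm (v i))\<^sup>2) * (\<Sum>i\<in>(UNIV::'m set). 1\<^sup>2)"
    using Cauchy_Schwarz_ineq_sum[of "\<lambda>i. norm (v i)" "\<lambda>_. 1" UNIV] by simp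
  finally have 1: "(norm (\<Sum>i\<in>UNIV. snd z $ i *\<^sub>R v i))\<^sup>2 \<le> real CARD('m) * (\<Sum>i\<in>UNIV. (norm (v i))\<^sup>2)"
    by (simp add: mult.commute)
  have "(norm (a + b))\<^sup>2 \<le> 2 * (norm a)\<^sup>2 + 2 * (norm b)\<^sup>2" for a b :: "real^'n"
    using zero_le_power2[of "norm (a - b)"] unfolding power2_norm_eq_inner
    by (simp add: inner_add inner_diff inner_commute)
  from this[of "\<Sum>i\<in>UNIV. snd z $ i *\<^sub>R v i" "fst z"]
  have 2: "(norm (fst (sub_grad v z)))\<^sup>2 \<le> 2 * (norm (\<Sum>i\<in>UNIV. snd z $ i *\<^sub>R v i))\<^sup>2 + 2 * (norm (fst z))\<^sup>2"
    by (simp add: sub_grad_def case_prod_beta)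
  have "(norm (snd (sub_grad v z)))\<^sup>2 = (\<Sum>i\<in>UNIV. (v i \<bullet> fst z)\<^sup>2)"
    unfolding power2_norm_eq_inner by (simp add: sub_grad_def case_prod_beta inner_vec_def power2_eq_square)
  also have "\<dots> \<le> (\<Sum>i\<in>UNIV. Cf\<^sup>2 * (norm (v i))\<^sup>2)"
  proof (intro sum_mono)
    fix i
    have "\<bar>v i \<bullet> fst z\<bar> \<le> norm (v i) * norm (fst z)" by (rule Cauchy_Schwarz_ineq2)
    also have "\<dots> \<le> norm (v i) * Cf" using d by (intro mult_left_mono) auto
    finally have "\<bar>v i \<bullet> fst z\<bar>\<^sup>2 \<le> (norm (v i) * Cf)\<^sup>2" by (intro power_mono) auto
    then show "(v i \<bullet> fst z)\<^sup>2 \<le> Cf\<^sup>2 * (norm (v i))\<^sup>2"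
      by (simp add: power_mult_distrib mult.commute)
  qed
  finally have 3: "(norm (snd (sub_grad v z)))\<^sup>2 \<le> Cf\<^sup>2 * (\<Sum>i\<in>UNIV. (norm (v i))\<^sup>2)"
    by (simp add: sum_distrib_left)
  have "(norm (fst z))\<^sup>2 \<le> Cf\<^sup>2" using d by (intro power_mono) auto
  then show ?thesis
    using 1 2 3 unfolding norm_prod_sq[of "sub_grad v z"] by (simp add: algebra_simps)
qed

section \<open>Independence and measurability\<close>

text \<open>Fubini on the joint law. It plays the part of conditional expectation: the inner
  integral freezes \<open>X w\<close> and redraws \<open>Y\<close> independently.\<close>

lemma (in prob_space) indep_var_integral_iterated:
  fixes h :: "'b \<times> 'b \<Rightarrow> real"
  assumes ind: "indep_var S X T Y"
    and h[measurable]: "h \<in> borel_measurable (S \<Otimes>\<^sub>M T)"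
    and int: "integrable M (\<lambda>w. h (X w, Y w))"
  shows "integrable M (\<lambda>w. \<integral>w'. h (X w, Y w') \<partial>M)"
    and "(\<integral>w. h (X w, Y w) \<partial>M) = (\<integral>w. (\<integral>w'. h (X w, Y w') \<partial>M) \<partial>M)"
proof -
  have X[measurable]: "X \<in> measurable M S" and Y[measurable]: "Y \<in> measurable M T"
    and D: "distr M S X \<Otimes>\<^sub>M distr M T Y = distr M (S \<Otimes>\<^sub>M T) (\<lambda>x. (X x, Y x))"
    using ind by (auto simp: indep_var_distribution_eq)
  interpret D: prob_space "distr M S X" by (rule prob_space_distr) fact
  interpret E: prob_space "distr M T Y" by (rule prob_space_distr) fact
  interpret DE: pair_sigma_finite "distr M S X" "distr M T Y" ..
  have I: "integrable (distr M S X \<Otimes>\<^sub>M distr M T Y) h"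
    unfolding D using int by (subst integrable_distr_eq) auto
  have inner: "(\<integral>y. h (X w, y) \<partial>distr M T Y) = (\<integral>w'. h (X w, Y w') \<partial>M)" if "w \<in> space M" for w
    using measurable_space[OF X that] by (intro integral_distr) measurable
  have Im: "(\<lambda>x. \<integral>y. h (x, y) \<partial>distr M T Y) \<in> borel_measurable S"
    by (rule E.borel_measurable_lebesgue_integral) (simp cong: measurable_cong_sets)
  have "integrable M (\<lambda>w. \<integral>y. h (X w, y) \<partial>distr M T Y)"
    using DE.integrable_fst'[OF I] Im by (subst (asm) integrable_distr_eq) auto
  then show "integrable M (\<lambda>w. \<integral>w'. h (X w, Y w') \<partial>M)"
    by (rule Bochner_Integration.integrable_cong[THEN iffD1, rotated 2]) (auto simp: inner)
  have "(\<integral>w. h (X w, Y w) \<partial>M) = (\<integral>p. h p \<partial>distr M (S \<Otimes>\<^sub>M T) (\<lambda>x. (X x, Y x)))"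
    by (subst integral_distr) auto
  also have "\<dots> = (\<integral>x. (\<integral>y. h (x, y) \<partial>distr M T Y) \<partial>distr M S X)"
    unfolding D[symmetric] by (rule DE.integral_fst'[OF I, symmetric])
  also have "\<dots> = (\<integral>w. (\<integral>y. h (X w, y) \<partial>distr M T Y) \<partial>M)"
    using Im by (intro integral_distr) auto
  also have "\<dots> = (\<integral>w. (\<integral>w'. h (X w, Y w') \<partial>M) \<partial>M)"
    by (intro Bochner_Integration.integral_cong refl inner)
  finally show "(\<integral>w. h (X w, Y w) \<partial>M) = (\<integral>w. (\<integral>w'. h (X w, Y w') \<partial>M) \<partial>M)" .
qed

lemma (in prob_space) expectation_le_sqrt:
  fixes X :: "'a \<Rightarrow> real"
  assumes "integrable M X" "integrable M (\<lambda>w. (X w)\<^sup>2)"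
  shows "expectation X \<le> sqrt (expectation (\<lambda>w. (X w)\<^sup>2))"
proof -
  have "(expectation X)\<^sup>2 \<le> expectation (\<lambda>w. (X w)\<^sup>2)"
    using variance_eq[OF assms] variance_positive[of X] by linarith
  then show ?thesis by (rule real_le_rsqrt)
qed

section \<open>Borel measurability of the inner and outer iterates\<close>

lemma borel_measurable_vec_nth [measurable (raw)]:
  fixes x :: "'a \<Rightarrow> real^'n"
  shows "x \<in> borel_measurable N \<Longrightarrow> (\<lambda>w. x w $ i) \<in> borel_measurable N"
  by (rule measurable_compose[OF _ borel_measurable_continuous_onI])
    (auto intro: continuous_intros)

lemma borel_measurable_vec_lambda [measurable (raw)]:
  fixes x :: "'a \<Rightarrow> 'n::finite \<Rightarrow> real"
  assumes [measurable]: "\<And>i. (\<lambda>w. x w i) \<in> borel_measurable N"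
  shows "(\<lambda>w. \<chi> i. x w i) \<in> borel_measurable N"
proof -
  have "(\<chi> i. x w i) = (\<Sum>i\<in>UNIV. x w i *\<^sub>R axis i 1)" for w
    by (simp add: vec_eq_iff axis_def if_distrib[of "\<lambda>a. _ * a"] cong: if_cong)
  then show ?thesis by simp
qed

lemma borel_measurable_fst_snd:
  fixes z :: "'a \<Rightarrow> 'b::euclidean_space \<times> 'c::euclidean_space"
  assumes "z \<in> borel_measurable N"
  shows "(\<lambda>w. fst (z w)) \<in> borel_measurable N" "(\<lambda>w. snd (z w)) \<in> borel_measurable N"
  by (rule measurable_compose[OF assms borel_measurable_continuous_onI], intro continuous_intros)+

lemma borel_measurable_omega_step:
  fixes z \<zeta> :: "'a \<Rightarrow> (real^'n) \<times> (real^'m::finite)"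
  assumes Cf: "0 < Cf" and z: "z \<in> borel_measurable N" and \<zeta>: "\<zeta> \<in> borel_measurable N"
  shows "(\<lambda>w. omega_step Cf (z w) (\<zeta> w)) \<in> borel_measurable N"
proof -
  note [measurable] = borel_measurable_fst_snd[OF z] borel_measurable_fst_snd[OF \<zeta>]
  have "continuous_on UNIV (closest_point (cball (0::real^'n) Cf))"
    using Cf by (intro continuous_on_closest_point) auto
  then have [measurable]: "closest_point (cball (0::real^'n) Cf) \<in> borel_measurable borel"
    by (rule borel_measurable_continuous_onI)
  show ?thesis
    unfolding omega_step_def by measurable
qed

lemma borel_measurable_sub_grad:
  fixes z :: "'a \<Rightarrow> (real^'n) \<times> (real^'m::finite)"
  assumes v[measurable]: "\<And>i. (\<lambda>w. v w i) \<in> borel_measurable N" and z: "z \<in> borel_measurable N"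
  shows "(\<lambda>w. sub_grad (v w) (z w)) \<in> borel_measurable N"
proof -
  note [measurable] = borel_measurable_fst_snd[OF z]
  show ?thesis unfolding sub_grad_def case_prod_beta by measurable
qed

text \<open>Measurability is asked only of the samples below \<open>n\<close>, so that
  \<open>N\<close> can be the product space over exactly those indices. The closed form of the prox
  step makes the induction work.\<close>

lemma borel_measurable_inner_iter:
  fixes G :: "'m::finite \<Rightarrow> real^'n \<Rightarrow> 'x \<Rightarrow> real^'n"
  assumes m: "2 \<le> CARD('m)" and Cf: "0 < Cf"
    and G: "\<And>i. (\<lambda>(x, y). G i x y) \<in> borel_measurable (borel \<Otimes>\<^sub>M \<mu>)"
    and x: "x \<in> borel_measurable N" and Y: "\<And>s. s < n \<Longrightarrow> Y s \<in> measurable N \<mu>"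
  shows "(\<lambda>w. inner_iter Cf G \<gamma> (x w) (\<lambda>s. Y s w) n) \<in> borel_measurable N"
  using Y
proof (induction n)
  case 0
  then show ?case by simp
next
  case (Suc n)
  have z: "(\<lambda>w. inner_iter Cf G \<gamma> (x w) (\<lambda>s. Y s w) n) \<in> borel_measurable N"
    using Suc by simp
  have "(\<lambda>w. G i (x w) (Y n w)) \<in> borel_measurable N" for i
    using measurable_compose[OF measurable_Pair[OF x Suc.prems[of n]] G[of i]] by simp
  then have "(\<lambda>w. sub_grad (\<lambda>i. G i (x w) (Y n w)) (inner_iter Cf G \<gamma> (x w) (\<lambda>s. Y s w) n)) \<in> borel_measurable N"
    by (intro borel_measurable_sub_grad z)
  then show ?case
    by (simp add: prox_omega[OF m Cf inner_iter_positive_feasible[OF m Cf]] borel_measurable_omega_step[OF Cf z])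
qed

lemma borel_measurable_fst_tail_average:
  fixes z :: "'a \<Rightarrow> nat \<Rightarrow> (real^'n) \<times> (real^'m::finite)"
  assumes z: "\<And>s. (\<lambda>w. z w s) \<in> borel_measurable N"
  shows "(\<lambda>w. fst (tail_average \<gamma> (z w) P S)) \<in> borel_measurable N"
proof -
  note [measurable] = borel_measurable_fst_snd[OF z]
  show ?thesis unfolding tail_average_def fst_scaleR fst_sum by measurable
qed

text \<open>Causality, as in \<open>msmd_cong\<close>: an iterate is a function of earlier samples
  alone, so these can be restricted to one block before independence is used.\<close>

lemma inner_iter_cong:
  "(\<And>s. s < n \<Longrightarrow> X s = X' s) \<Longrightarrow> inner_iter Cf G \<gamma> x X n = inner_iter Cf G \<gamma> x X' n"
  by (induction n) auto

lemma msmd_cong: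
  "(\<And>j s. j < k \<Longrightarrow> X (j, s) = X' (j, s)) \<Longrightarrow> msmd Cf G S r \<gamma> \<alpha> x0 X k = msmd Cf G S r \<gamma> \<alpha> x0 X' k"
proof (induction k)
  case (Suc k)
  then have "(\<lambda>s. X (k, s)) = (\<lambda>s. X' (k, s))" by auto
  with Suc show ?case by simp
qed simp

lemma borel_measurable_msmd:
  fixes G :: "'m::finite \<Rightarrow> real^'n \<Rightarrow> 'x \<Rightarrow> real^'n"
  assumes m: "2 \<le> CARD('m)" and Cf: "0 < Cf"
    and G: "\<And>i. (\<lambda>(x, y). G i x y) \<in> borel_measurable (borel \<Otimes>\<^sub>M \<mu>)"
    and Y: "\<And>j s. j < k \<Longrightarrow> Y (j, s) \<in> measurable N \<mu>"
  shows "(\<lambda>w. msmd Cf G S r \<gamma> \<alpha> x0 (\<lambda>p. Y p w) k) \<in> borel_measurable N"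
  using Y
proof (induction k)
  case (Suc k)
  then have x[measurable]: "(\<lambda>w. msmd Cf G S r \<gamma> \<alpha> x0 (\<lambda>p. Y p w) k) \<in> borel_measurable N" by simp
  have [measurable]: "(\<lambda>w. fst (tail_average (\<gamma> k)
         (inner_iter Cf G (\<gamma> k) (msmd Cf G S r \<gamma> \<alpha> x0 (\<lambda>p. Y p w) k) (\<lambda>s. Y (k, s) w))
         (nat \<lceil>r * real (S k)\<rceil>) (S k))) \<in> borel_measurable N"
    using Suc.prems
    by (intro borel_measurable_fst_tail_average borel_measurable_inner_iter[OF m Cf G x]) auto
  show ?case by simp
qed simp

section \<open>Tail averages with constant step size, and the smoothness inequality\<close>

lemma fst_tail_average_const:
  "\<gamma> \<noteq> 0 \<Longrightarrow> P \<le> S \<Longrightarrow>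
    fst (tail_average (\<lambda>_. \<gamma>) z P S) = (1 / (real S - real P + 1)) *\<^sub>R (\<Sum>s=P..S. fst (z s))"
  by (simp add: tail_average_def fst_sum Suc_diff_le of_nat_diff scaleR_sum_right[symmetric] add.commute)

text \<open>Jensen's inequality for the square, in the form of Cauchy-Schwarz over the
  \<open>S - P + 1\<close> averaged terms.\<close>

lemma norm_fst_tail_average_diff_le:
  fixes z :: "nat \<Rightarrow> (real^'n) \<times> 'b::real_vector"
  assumes \<gamma>: "\<gamma> \<noteq> 0" and PS: "P \<le> S"
  shows "(norm (fst (tail_average (\<lambda>_. \<gamma>) z P S) - d))\<^sup>2
    \<le> (\<Sum>s=P..S. (norm (fst (z s) - d))\<^sup>2) / (real S - real P + 1)"
proof -
  define c where "c = real S - real P + 1"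
  have c: "0 < c" "real (card {P..S}) = c"
    using PS by (simp_all add: c_def of_nat_diff)
  have "d = (1 / c) *\<^sub>R (\<Sum>s=P..S. d)"
    using c by (simp only: sum_constant_scaleR scaleR_scaleR) simp
  then have "fst (tail_average (\<lambda>_. \<gamma>) z P S) - d = (1 / c) *\<^sub>R (\<Sum>s=P..S. fst (z s) - d)"
    by (simp add: fst_tail_average_const[OF \<gamma> PS] c_def[symmetric] sum_subtractf scaleR_diff_right)
  then have "(norm (fst (tail_average (\<lambda>_. \<gamma>) z P S) - d))\<^sup>2 = (norm (\<Sum>s=P..S. fst (z s) - d))\<^sup>2 / c\<^sup>2"
    by (simp add: power_divide)
  also have "\<dots> \<le> (\<Sum>s=P..S. norm (fst (z s) - d))\<^sup>2 / c\<^sup>2"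
    by (intro divide_right_mono power_mono norm_sum) auto
  also have "\<dots> \<le> ((\<Sum>s=P..S. (norm (fst (z s) - d))\<^sup>2) * (\<Sum>s=P..S. 1\<^sup>2)) / c\<^sup>2"
    using Cauchy_Schwarz_ineq_sum[of "\<lambda>s. norm (fst (z s) - d)" "\<lambda>_. 1" "{P..S}"]
    by (intro divide_right_mono) simp_all
  also have "(\<Sum>s=P..S. 1\<^sup>2) = c" using c by simp
  finally show ?thesis using c by (simp add: c_def[symmetric] power2_eq_square)
qed

lemma norm_fst_tail_average_le:
  fixes z :: "nat \<Rightarrow> (real^'n) \<times> 'b::real_vector"
  assumes \<gamma>: "\<gamma> \<noteq> 0" and PS: "P \<le> S" and z: "\<And>s. norm (fst (z s)) \<le> C"
  shows "norm (fst (tail_average (\<lambda>_. \<gamma>) z P S)) \<le> C"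
proof -
  have "norm (\<Sum>s=P..S. fst (z s)) \<le> (real S - real P + 1) * C"
    using sum_norm_le[of "{P..S}" "\<lambda>s. fst (z s)" "\<lambda>_. C"] z PS by (simp add: of_nat_diff algebra_simps)
  moreover have "0 < real S - real P + 1" using PS by simp
  ultimately show ?thesis
    by (simp add: fst_tail_average_const[OF \<gamma> PS] pos_divide_le_eq mult.commute)
qed

text \<open>The mean value theorem on the segment gives the coefficient \<open>L\<close> in place of
  the sharp \<open>L / 2\<close>; the constant of the final bound absorbs the difference.\<close>

lemma lipschitz_gradient_descent:
  fixes f :: "'a::real_inner \<Rightarrow> real"
  assumes grad: "\<And>x. GDERIV f x :> g x" and lip: "L-lipschitz_on UNIV g"
  shows "f (x + h) \<le> f x + g x \<bullet> h + L * (norm h)\<^sup>2"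
proof -
  have "((\<lambda>t. f (x + t *\<^sub>R h)) has_real_derivative g (x + t *\<^sub>R h) \<bullet> h) (at t)" for t
  proof -
    have "(f has_derivative (\<lambda>k. k \<bullet> g (x + t *\<^sub>R h))) (at (x + t *\<^sub>R h))"
      using grad by (simp add: gderiv_def)
    then have "((\<lambda>t. f (x + t *\<^sub>R h)) has_derivative (\<lambda>s. (s *\<^sub>R h) \<bullet> g (x + t *\<^sub>R h))) (at t)"
      by (rule has_derivative_compose[rotated]) (auto intro!: derivative_eq_intros)
    moreover have "(\<lambda>s. (s *\<^sub>R h) \<bullet> g (x + t *\<^sub>R h)) = (*) (g (x + t *\<^sub>R h) \<bullet> h)"
      by (simp add: fun_eq_iff inner_commute)
    ultimately show ?thesis
      by (simp add: has_field_derivative_def)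
  qed
  then obtain t where t: "0 < t" "t < 1" "f (x + h) - f x = g (x + t *\<^sub>R h) \<bullet> h"
    using MVT2[of 0 1 "\<lambda>t. f (x + t *\<^sub>R h)" "\<lambda>t. g (x + t *\<^sub>R h) \<bullet> h"] by auto
  have L: "0 \<le> L" using lip by (rule lipschitz_on_nonneg)
  have "g (x + t *\<^sub>R h) \<bullet> h - g x \<bullet> h \<le> norm (g (x + t *\<^sub>R h) - g x) * norm h"
    using norm_cauchy_schwarz[of "g (x + t *\<^sub>R h) - g x" h] by (simp add: inner_diff_left)
  also have "\<dots> \<le> (L * norm (t *\<^sub>R h)) * norm h"
    using lipschitz_onD[OF lip, of "x + t *\<^sub>R h" x] by (intro mult_right_mono) (simp_all add: dist_norm)
  also have "\<dots> \<le> (L * norm h) * norm h"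
    using L t by (intro mult_right_mono mult_left_mono) (auto simp: mult_left_le_one_le)
  finally show ?thesis using t(3) by (simp add: power2_eq_square mult.assoc)
qed

section \<open>The inner loop\<close>

definition step_size :: "nat \<Rightarrow> real \<Rightarrow> real \<Rightarrow> real \<Rightarrow> nat \<Rightarrow> real" where
  "step_size m Cf \<delta> \<theta> S = \<theta> / (Mstar m Cf \<delta> * sqrt (real S))"

text \<open>The bound of \<open>norm_sub_grad_le\<close> with every squared gradient norm replaced
  by \<open>Cf\<^sup>2\<close>.\<close>

definition sub_grad_bound :: "nat \<Rightarrow> real \<Rightarrow> real" where
  "sub_grad_bound m Cf = (2 * real m + Cf\<^sup>2) * (real m * Cf\<^sup>2) + 2 * Cf\<^sup>2"

text \<open>The regret bound divided by the step size: the first summand comes from the initial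
  divergence, the second from the gradient norms. The factor \<open>1 / (1 - r)\<close> accounts for
  the length of the tail window.\<close>

definition gap_const :: "nat \<Rightarrow> real \<Rightarrow> real \<Rightarrow> real \<Rightarrow> real \<Rightarrow> real" where
  "gap_const m Cf \<delta> \<theta> r = (Mstar m Cf \<delta> / \<theta>
    + \<theta> * sub_grad_bound m Cf / (Mstar m Cf \<delta> * omega_modulus m Cf)) / (1 - r)"

locale msmd_setting = prob_space M for M :: "'w measure" +
  fixes f :: "'m::finite \<Rightarrow> real^'n \<Rightarrow> real"
    and g :: "'m \<Rightarrow> real^'n \<Rightarrow> real^'n"
    and G :: "'m \<Rightarrow> real^'n \<Rightarrow> 'x \<Rightarrow> real^'n"
    and \<mu> :: "'x measure"
    and L Cf \<delta> \<theta> r :: real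
  assumes m: "2 \<le> CARD('m)"
    and grad: "\<And>i x. GDERIV (f i) x :> g i x"
    and lip: "\<And>i. L-lipschitz_on UNIV (g i)"
    and Cf: "0 < Cf" and \<theta>: "0 < \<theta>" and r: "0 < r" "r < 1"
    and \<mu>: "prob_space \<mu>"
    and G: "\<And>i. (\<lambda>(x, y). G i x y) \<in> borel_measurable (borel \<Otimes>\<^sub>M \<mu>)"
begin

lemma Mstar_pos: "0 < Mstar CARD('m) Cf \<delta>"
proof -
  have "0 < (2 + ln (real CARD('m))) * (real CARD('m))\<^sup>2 * Cf ^ 4"
    using m Cf by (intro mult_pos_pos) (auto intro: add_pos_pos)
  moreover have "0 \<le> (1 / 2 + ln (real CARD('m))) * (real CARD('m))\<^sup>2 * Cf\<^sup>2 * \<delta>\<^sup>2"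
    using m by (intro mult_nonneg_nonneg) auto
  ultimately show ?thesis unfolding Mstar_def real_sqrt_gt_0_iff by linarith
qed

lemma omega_modulus_card_pos: "0 < omega_modulus CARD('m) Cf"
  using m Cf by (rule omega_modulus_pos)

lemma sub_grad_bound_nonneg: "0 \<le> sub_grad_bound CARD('m) Cf"
  by (simp add: sub_grad_bound_def)

lemma gap_const_nonneg: "0 \<le> gap_const CARD('m) Cf \<delta> \<theta> r"
  using Mstar_pos omega_modulus_card_pos sub_grad_bound_nonneg \<theta> r by (simp add: gap_const_def)

lemma step_size_pos: "0 < S \<Longrightarrow> 0 < step_size CARD('m) Cf \<delta> \<theta> S"
  using Mstar_pos \<theta> by (simp add: step_size_def)

text \<open>The last claim is Jensen's inequality. It puts the descent direction into the ball of
  radius \<open>Cf\<close>, which makes the saddle point an admissible comparison point.\<close>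

lemma stoch_grad_moments:
  assumes sg: "stoch_grad \<mu> g G Cf \<delta> x"
  shows "integrable \<mu> (G i x)" "(\<integral>y. G i x y \<partial>\<mu>) = g i x"
    and "integrable \<mu> (\<lambda>y. (norm (G i x y))\<^sup>2)" "(\<integral>y. (norm (G i x y))\<^sup>2 \<partial>\<mu>) \<le> Cf\<^sup>2"
    and "norm (g i x) \<le> Cf"
proof -
  interpret \<mu>: prob_space \<mu> by (rule \<mu>)
  have b: "has_bochner_integral \<mu> (G i x) (g i x)"
    and n: "(\<integral>\<^sup>+y. ennreal ((norm (G i x y))\<^sup>2) \<partial>\<mu>) \<le> ennreal (Cf\<^sup>2)"
    using sg by (auto simp: stoch_grad_def)
  show I: "integrable \<mu> (G i x)" and E: "(\<integral>y. G i x y \<partial>\<mu>) = g i x"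
    using b by (auto simp: has_bochner_integral_iff)
  then have [measurable]: "G i x \<in> borel_measurable \<mu>" by auto
  have "(\<integral>\<^sup>+y. ennreal ((norm (G i x y))\<^sup>2) \<partial>\<mu>) < \<infinity>"
    using n by (auto intro: le_less_trans)
  then show I2: "integrable \<mu> (\<lambda>y. (norm (G i x y))\<^sup>2)"
    by (intro integrableI_nonneg) auto
  then have "ennreal (\<integral>y. (norm (G i x y))\<^sup>2 \<partial>\<mu>) \<le> ennreal (Cf\<^sup>2)"
    using n by (subst nn_integral_eq_integral[symmetric]) auto
  then show E2: "(\<integral>y. (norm (G i x y))\<^sup>2 \<partial>\<mu>) \<le> Cf\<^sup>2" by simp
  have "norm (g i x) \<le> (\<integral>y. norm (G i x y) \<partial>\<mu>)"
    unfolding E[symmetric] by (rule integral_norm_bound)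
  also have "\<dots> \<le> sqrt (\<integral>y. (norm (G i x y))\<^sup>2 \<partial>\<mu>)"
    using I I2 by (intro \<mu>.expectation_le_sqrt) auto
  also have "\<dots> \<le> sqrt (Cf\<^sup>2)" using E2 by (rule real_sqrt_le_mono)
  finally show "norm (g i x) \<le> Cf" using Cf by simp
qed

lemma bounded_feasible: "bounded (feasible Cf :: ((real^'n) \<times> (real^'m)) set)"
  unfolding feasible_def
  by (intro bounded_Times compact_imp_bounded compact_prob_simplex bounded_cball)

lemma inner_iter_feasible: "inner_iter Cf G \<gamma> x X s \<in> feasible Cf"
  using inner_iter_positive_feasible[OF m Cf, of G \<gamma> x X s] by (simp add: positive_feasible_def)

lemma nat_ceiling_le: "nat \<lceil>r * real S\<rceil> \<le> S"
proof -
  have "r * real S \<le> real S"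
    using r by (simp add: mult_left_le_one_le)
  then show ?thesis by simp
qed

context
  fixes x :: "real^'n" and Y :: "nat \<Rightarrow> 'w \<Rightarrow> 'x"
  assumes sg: "stoch_grad \<mu> g G Cf \<delta> x"
    and indep: "indep_vars (\<lambda>_. \<mu>) Y UNIV" and distr: "\<And>s. distr M \<mu> (Y s) = \<mu>"
begin

lemma sample_measurable: "Y s \<in> measurable M \<mu>"
  using indep by (auto simp: indep_vars_def)

lemma integral_sample:
  fixes h :: "'x \<Rightarrow> 'b::{banach, second_countable_topology}"
  assumes "integrable \<mu> h"
  shows "integrable M (\<lambda>w. h (Y s w))" "(\<integral>w. h (Y s w) \<partial>M) = (\<integral>y. h y \<partial>\<mu>)"
proof -
  have h: "h \<in> borel_measurable \<mu>" using assms by auto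
  show "integrable M (\<lambda>w. h (Y s w))"
    using assms integrable_distr_eq[OF sample_measurable h, of s] distr by simp
  show "(\<integral>w. h (Y s w) \<partial>M) = (\<integral>y. h y \<partial>\<mu>)"
    using integral_distr[OF sample_measurable h, of s] distr by simp
qed

text \<open>Expectation of \<open>inner_iter_regret\<close> against the saddle point, at a
  deterministic outer point \<open>x\<close>. The iterate \<open>z s\<close> depends on samples
  before \<open>s\<close> only; averaging out sample \<open>s\<close> replaces the stochastic field
  by the exact one, to which \<open>sub_grad_saddle\<close> applies.\<close>

lemma inner_iter_gap_sum:
  assumes \<gamma>: "0 \<le> \<gamma>"
  defines "d \<equiv> common_descent (\<lambda>i. g i x)"
    and "z \<equiv> \<lambda>s w. inner_iter Cf G (\<lambda>_. \<gamma>) x (\<lambda>s. Y s w) s"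
  shows "\<gamma> * (\<Sum>s<N. expectation (\<lambda>w. (norm (fst (z s w) - d))\<^sup>2))
    \<le> 1 + \<gamma>\<^sup>2 / (2 * omega_modulus CARD('m) Cf) * (real N * sub_grad_bound CARD('m) Cf)"
proof -
  obtain l where l: "l \<in> prob_simplex" "d = - (\<Sum>i\<in>UNIV. l $ i *\<^sub>R g i x)"
    unfolding d_def using common_descent_dual[of "\<lambda>i. g i x"] by metis
  define u where "u = (d, l)"
  have u: "u \<in> feasible Cf"
    unfolding u_def d_def using l(1) norm_common_descent_le[OF stoch_grad_moments(5)[OF sg]]
    by (simp add: feasible_def)
  define \<zeta> where "\<zeta> s w = sub_grad (\<lambda>i. G i x (Y s w)) (z s w)" for s w
  have zf: "z s w \<in> feasible Cf" for s w
    unfolding z_def by (rule inner_iter_feasible)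
  have zm[measurable]: "z s \<in> borel_measurable M" for s
    unfolding z_def by (rule borel_measurable_inner_iter[OF m Cf G]) (simp_all add: sample_measurable)
  have Gx[measurable]: "G i x \<in> borel_measurable \<mu>" for i
    using stoch_grad_moments(1)[OF sg] by auto
  note sample_measurable[measurable]
  have \<zeta>m[measurable]: "\<zeta> s \<in> borel_measurable M" for s
    unfolding \<zeta>_def[abs_def] by (intro borel_measurable_sub_grad zm) measurable
  obtain R where R: "\<And>z. z \<in> feasible Cf \<Longrightarrow> norm (z :: (real^'n) \<times> (real^'m)) \<le> R"
    using bounded_feasible by (auto simp: bounded_iff)
  have R0: "0 \<le> R" using R[OF u] norm_ge_zero order_trans by blast
  have zu: "norm (z s w - u) \<le> 2 * R" for s w
    using norm_triangle_ineq4[of "z s w" u] R[OF zf] R[OF u] by (smt (verit))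

  have Isum: "integrable M (\<lambda>w. (2 * real CARD('m) + Cf\<^sup>2) * (\<Sum>i\<in>UNIV. (norm (G i x (Y s w)))\<^sup>2) + 2 * Cf\<^sup>2)" for s
    by (intro Bochner_Integration.integrable_add integrable_mult_right Bochner_Integration.integrable_sum
        integral_sample(1)[OF stoch_grad_moments(3)[OF sg]] integrable_const)
  have \<zeta>le: "(norm (\<zeta> s w))\<^sup>2 \<le> (2 * real CARD('m) + Cf\<^sup>2) * (\<Sum>i\<in>UNIV. (norm (G i x (Y s w)))\<^sup>2) + 2 * Cf\<^sup>2" for s w
    unfolding \<zeta>_def by (rule norm_sub_grad_le[OF zf])
  have I\<zeta>: "integrable M (\<lambda>w. (norm (\<zeta> s w))\<^sup>2)" for s
    by (rule Bochner_Integration.integrable_bound[OF Isum[of s]]) (use \<zeta>le in \<open>auto intro!: AE_I2 order_trans[OF _ abs_ge_self]\<close>)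
  have E\<zeta>: "expectation (\<lambda>w. (norm (\<zeta> s w))\<^sup>2) \<le> sub_grad_bound CARD('m) Cf" for s
  proof -
    have "expectation (\<lambda>w. (norm (\<zeta> s w))\<^sup>2)
        \<le> expectation (\<lambda>w. (2 * real CARD('m) + Cf\<^sup>2) * (\<Sum>i\<in>UNIV. (norm (G i x (Y s w)))\<^sup>2) + 2 * Cf\<^sup>2)"
      by (intro integral_mono I\<zeta> Isum \<zeta>le)
    also have "\<dots> = (2 * real CARD('m) + Cf\<^sup>2) * (\<Sum>i\<in>UNIV. (\<integral>y. (norm (G i x y))\<^sup>2 \<partial>\<mu>)) + 2 * Cf\<^sup>2"
      using integral_sample[OF stoch_grad_moments(3)[OF sg]]
      by (simp add: Bochner_Integration.integral_add Bochner_Integration.integral_sum prob_space)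
    also have "\<dots> \<le> (2 * real CARD('m) + Cf\<^sup>2) * (\<Sum>i\<in>(UNIV::'m set). Cf\<^sup>2) + 2 * Cf\<^sup>2"
      by (intro add_right_mono mult_left_mono sum_mono stoch_grad_moments(4)[OF sg]) simp
    finally show ?thesis by (simp add: sub_grad_bound_def)
  qed
  have I\<zeta>z: "integrable M (\<lambda>w. \<zeta> s w \<bullet> (z s w - u))" for s
  proof (rule Bochner_Integration.integrable_bound)
    show "integrable M (\<lambda>w. ((norm (\<zeta> s w))\<^sup>2 + 1) * (2 * R))"
      using I\<zeta> by simp
    \<comment> \<open>The second factor is bounded, and \<open>t \<le> t\<^sup>2 + 1\<close> reduces
      the first to its integrable square.\<close>
    have "\<bar>\<zeta> s w \<bullet> (z s w - u)\<bar> \<le> ((norm (\<zeta> s w))\<^sup>2 + 1) * (2 * R)" for w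
    proof -
      have "\<bar>\<zeta> s w \<bullet> (z s w - u)\<bar> \<le> norm (\<zeta> s w) * norm (z s w - u)"
        by (rule Cauchy_Schwarz_ineq2)
      also have "\<dots> \<le> ((norm (\<zeta> s w))\<^sup>2 + 1) * (2 * R)"
      proof (rule mult_mono)
        show "norm (\<zeta> s w) \<le> (norm (\<zeta> s w))\<^sup>2 + 1"
          using zero_le_power2[of "norm (\<zeta> s w) - 1"] by (simp add: power2_eq_square algebra_simps)
            (smt (verit) norm_ge_zero zero_le_mult_iff)
      qed (use zu in auto)
      finally show ?thesis .
    qed
    then show "AE w in M. norm (\<zeta> s w \<bullet> (z s w - u)) \<le> norm (((norm (\<zeta> s w))\<^sup>2 + 1) * (2 * R))"
      using R0 by (auto simp: abs_mult)
    show "(\<lambda>w. \<zeta> s w \<bullet> (z s w - u)) \<in> borel_measurable M" by measurable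
  qed
  have E\<zeta>z: "expectation (\<lambda>w. (norm (fst (z s w) - d))\<^sup>2) \<le> expectation (\<lambda>w. \<zeta> s w \<bullet> (z s w - u))" for s
  proof -
    \<comment> \<open>Past samples \<open>{..<s}\<close> against the current sample
      \<open>{s}\<close>: \<open>h\<close> rewrites the integrand as a function of these two
      independent blocks.\<close>
    define \<phi> where "\<phi> X = inner_iter Cf G (\<lambda>_. \<gamma>) x X s" for X
    define S where "S = PiM {..<s} (\<lambda>_. \<mu>)"
    define T where "T = PiM {s} (\<lambda>_. \<mu>)"
    define X0 where "X0 w = restrict (\<lambda>i. Y i w) {..<s}" for w
    define Y0 where "Y0 w = restrict (\<lambda>i. Y i w) {s}" for w
    define h where "h = (\<lambda>(X, X'). sub_grad (\<lambda>i. G i x (X' s)) (\<phi> X) \<bullet> (\<phi> X - u))"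
    have ind: "indep_var S X0 T Y0"
      unfolding S_def T_def X0_def[abs_def] Y0_def[abs_def] by (rule indep_var_restrict[OF indep]) auto
    have \<phi>: "\<phi> \<in> borel_measurable S"
      unfolding \<phi>_def S_def by (rule borel_measurable_inner_iter[OF m Cf G]) auto
    then have \<phi>1[measurable]: "(\<lambda>p. \<phi> (fst p)) \<in> borel_measurable (S \<Otimes>\<^sub>M T)" by measurable
    have [measurable]: "(\<lambda>p. snd p s) \<in> measurable (S \<Otimes>\<^sub>M T) \<mu>"
      unfolding T_def by measurable
    have "(\<lambda>p. sub_grad (\<lambda>i. G i x (snd p s)) (\<phi> (fst p))) \<in> borel_measurable (S \<Otimes>\<^sub>M T)"
      by (intro borel_measurable_sub_grad \<phi>1) measurable
    then have h: "h \<in> borel_measurable (S \<Otimes>\<^sub>M T)"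
      unfolding h_def case_prod_beta by measurable
    have \<phi>X: "\<phi> (X0 w) = z s w" for w
      unfolding \<phi>_def X0_def z_def by (rule inner_iter_cong) simp
    have hw: "h (X0 w, Y0 w') = sub_grad (\<lambda>i. G i x (Y s w')) (z s w) \<bullet> (z s w - u)" for w w'
      by (simp add: h_def \<phi>X Y0_def)
    have hww: "h (X0 w, Y0 w) = \<zeta> s w \<bullet> (z s w - u)" for w
      by (simp add: hw \<zeta>_def)
    have "(\<integral>w'. h (X0 w, Y0 w') \<partial>M) = sub_grad (\<lambda>i. g i x) (z s w) \<bullet> (z s w - u)" for w
      unfolding hw sub_grad_inner_eq
      using integral_sample[OF stoch_grad_moments(1)[OF sg]]
      by (simp add: stoch_grad_moments(2)[OF sg] prob_space Bochner_Integration.integral_sum)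
    note it = indep_var_integral_iterated[OF ind h, unfolded hww this, OF I\<zeta>z]
    have le: "(norm (fst (z s w) - d))\<^sup>2 \<le> sub_grad (\<lambda>i. g i x) (z s w) \<bullet> (z s w - u)" for w
      unfolding u_def d_def using l zf[of s w] 
      by (intro sub_grad_saddle) (auto simp: d_def feasible_def)
    have "expectation (\<lambda>w. (norm (fst (z s w) - d))\<^sup>2) \<le> expectation (\<lambda>w. sub_grad (\<lambda>i. g i x) (z s w) \<bullet> (z s w - u))"
    proof (rule integral_mono_AE)
      show "integrable M (\<lambda>w. (norm (fst (z s w) - d))\<^sup>2)"
        by (rule Bochner_Integration.integrable_bound[OF it(1)])
          (use le borel_measurable_fst_snd[OF zm] in \<open>auto intro: order_trans[OF _ abs_ge_self]\<close>)
    qed (use le it(1) in auto)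
    then show ?thesis using it(2) by simp
  qed
  have "\<gamma> * (\<Sum>s<N. expectation (\<lambda>w. (norm (fst (z s w) - d))\<^sup>2)) \<le> \<gamma> * (\<Sum>s<N. expectation (\<lambda>w. \<zeta> s w \<bullet> (z s w - u)))"
    using \<gamma> E\<zeta>z by (intro mult_left_mono sum_mono) auto
  also have "\<dots> = expectation (\<lambda>w. \<gamma> * (\<Sum>s<N. \<zeta> s w \<bullet> (z s w - u)))"
    using I\<zeta>z by (simp add: Bochner_Integration.integral_sum)
  also have "\<dots> \<le> expectation (\<lambda>w. 1 + \<gamma>\<^sup>2 / (2 * omega_modulus CARD('m) Cf) * (\<Sum>s<N. (norm (\<zeta> s w))\<^sup>2))"
    using I\<zeta>z I\<zeta> inner_iter_regret[OF m Cf u, where \<gamma>=\<gamma> and N=N and G=G and x=x]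
    by (intro integral_mono) (auto simp: \<zeta>_def z_def)
  also have "\<dots> = 1 + \<gamma>\<^sup>2 / (2 * omega_modulus CARD('m) Cf) * (\<Sum>s<N. expectation (\<lambda>w. (norm (\<zeta> s w))\<^sup>2))"
    using I\<zeta> by (simp add: Bochner_Integration.integral_add Bochner_Integration.integral_sum prob_space)
  also have "\<dots> \<le> 1 + \<gamma>\<^sup>2 / (2 * omega_modulus CARD('m) Cf) * (\<Sum>s<N. sub_grad_bound CARD('m) Cf)"
    using omega_modulus_card_pos by (intro add_left_mono mult_left_mono sum_mono E\<zeta>) auto
  finally show ?thesis by simp
qed

text \<open>With a step size of order \<open>1 / sqrt S\<close>, both parts of the summed gap are of
  order \<open>sqrt S\<close>; averaging over at least \<open>(1 - r) * S\<close> indices leaves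
  \<open>1 / sqrt S\<close>.\<close>

lemma inner_iter_tail_gap:
  assumes S: "0 < S"
  defines "d \<equiv> common_descent (\<lambda>i. g i x)"
    and "da \<equiv> \<lambda>w. fst (tail_average (\<lambda>_. step_size CARD('m) Cf \<delta> \<theta> S)
      (inner_iter Cf G (\<lambda>_. step_size CARD('m) Cf \<delta> \<theta> S) x (\<lambda>s. Y s w)) (nat \<lceil>r * real S\<rceil>) S)"
  shows "integrable M (\<lambda>w. (norm (da w - d))\<^sup>2)"
    and "expectation (\<lambda>w. (norm (da w - d))\<^sup>2) \<le> gap_const CARD('m) Cf \<delta> \<theta> r / sqrt (real S)"
    and "da \<in> borel_measurable M"
    and "norm (da w) \<le> Cf"
proof -
  define \<gamma> where "\<gamma> = step_size CARD('m) Cf \<delta> \<theta> S"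
  define P where "P = nat \<lceil>r * real S\<rceil>"
  define z where "z s w = inner_iter Cf G (\<lambda>_. \<gamma>) x (\<lambda>s. Y s w) s" for s w
  let ?Ms = "Mstar CARD('m) Cf \<delta>"
  let ?zb = "sub_grad_bound CARD('m) Cf"
  let ?\<kappa> = "omega_modulus CARD('m) Cf"
  have da: "da w = fst (tail_average (\<lambda>_. \<gamma>) (\<lambda>s. z s w) P S)" for w
    by (simp add: da_def \<gamma>_def P_def z_def)
  have \<gamma>: "0 < \<gamma>" unfolding \<gamma>_def by (rule step_size_pos[OF S])
  have P: "P \<le> S" unfolding P_def by (rule nat_ceiling_le)
  have zf: "z s w \<in> feasible Cf" for s w unfolding z_def by (rule inner_iter_feasible)
  have zC: "norm (fst (z s w)) \<le> Cf" for s w using zf[of s w] by (auto simp: feasible_def)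
  have zm: "(\<lambda>w. z s w) \<in> borel_measurable M" for s
    unfolding z_def by (rule borel_measurable_inner_iter[OF m Cf G]) (simp_all add: sample_measurable)
  show dam[measurable]: "da \<in> borel_measurable M"
    unfolding da[abs_def] by (rule borel_measurable_fst_tail_average[OF zm])
  have daC: "norm (da w) \<le> Cf" for w
    unfolding da using \<gamma> P zC by (intro norm_fst_tail_average_le) auto
  then show "norm (da w) \<le> Cf" .
  have dC: "norm d \<le> Cf"
    unfolding d_def by (rule norm_common_descent_le[OF stoch_grad_moments(5)[OF sg]])
  have bd: "(norm (v - d))\<^sup>2 \<le> (2 * Cf)\<^sup>2" if "norm v \<le> Cf" for v
    using norm_triangle_ineq4[of v d] dC that by (intro power_mono) auto
  note [measurable] = borel_measurable_fst_snd[OF zm]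
  show I: "integrable M (\<lambda>w. (norm (da w - d))\<^sup>2)"
    using bd[OF daC] by (intro integrable_const_bound[where B="(2 * Cf)\<^sup>2"]) auto
  have Iz: "integrable M (\<lambda>w. (norm (fst (z s w) - d))\<^sup>2)" for s
    using bd[OF zC] by (intro integrable_const_bound[where B="(2 * Cf)\<^sup>2"]) auto
  define E where "E s = expectation (\<lambda>w. (norm (fst (z s w) - d))\<^sup>2)" for s
  have E0: "0 \<le> E s" for s unfolding E_def by (rule Bochner_Integration.integral_nonneg) auto
  \<comment> \<open>The tail average includes index \<open>S\<close>, so \<open>Suc S\<close>
    iterates are counted; \<open>Suc S \<le> 2 * S\<close> then removes the 2 in the
    denominator.\<close>
  have "\<gamma> * (\<Sum>s<Suc S. E s) \<le> 1 + \<gamma>\<^sup>2 / (2 * ?\<kappa>) * (real (Suc S) * ?zb)"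
    using inner_iter_gap_sum[of \<gamma> "Suc S"] \<gamma> by (simp add: E_def d_def z_def)
  also have "\<dots> \<le> 1 + \<gamma>\<^sup>2 / (2 * ?\<kappa>) * ((2 * real S) * ?zb)"
    using S omega_modulus_card_pos sub_grad_bound_nonneg by (intro add_left_mono mult_left_mono mult_right_mono) auto
  also have "\<dots> = \<gamma> * (1 / \<gamma> + \<gamma> * real S * ?zb / ?\<kappa>)"
    using \<gamma> by (simp add: field_simps power2_eq_square)
  finally have "(\<Sum>s<Suc S. E s) \<le> 1 / \<gamma> + \<gamma> * real S * ?zb / ?\<kappa>"
    using \<gamma> by (simp only: mult_le_cancel_left_pos)
  also have "1 / \<gamma> = sqrt (real S) * (?Ms / \<theta>)"
    by (simp add: \<gamma>_def step_size_def)
  also have "\<gamma> * real S * ?zb / ?\<kappa> = sqrt (real S) * (\<theta> * ?zb / (?Ms * ?\<kappa>))"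
  proof -
    have "\<gamma> * real S = \<theta> / ?Ms * (real S / sqrt (real S))"
      by (simp add: \<gamma>_def step_size_def)
    then show ?thesis by (simp add: real_div_sqrt)
  qed
  finally have sumE: "(\<Sum>s<Suc S. E s) \<le> sqrt (real S) * (?Ms / \<theta> + \<theta> * ?zb / (?Ms * ?\<kappa>))"
    by (simp add: distrib_left)
  \<comment> \<open>Rounding up costs less than one index, which the closed window
    \<open>P..S\<close> gives back.\<close>
  have "real P < r * real S + 1"
    unfolding P_def using r by (simp add: real_nat_ceiling_ge) linarith
  then have c: "(1 - r) * real S \<le> real S - real P + 1" by (simp add: algebra_simps)
  have rS: "0 < (1 - r) * real S" using r S by simp
  have "expectation (\<lambda>w. (norm (da w - d))\<^sup>2) \<le> expectation (\<lambda>w. (\<Sum>s=P..S. (norm (fst (z s w) - d))\<^sup>2) / (real S - real P + 1))"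
    unfolding da using I[unfolded da] Iz \<gamma> P by (intro integral_mono norm_fst_tail_average_diff_le) auto
  also have "\<dots> = (\<Sum>s=P..S. E s) / (real S - real P + 1)"
    unfolding E_def using Iz by (simp add: Bochner_Integration.integral_sum)
  also have "\<dots> \<le> (\<Sum>s<Suc S. E s) / ((1 - r) * real S)"
    using c rS E0 by (intro frac_le sum_mono2 sum_nonneg) auto
  also have "\<dots> \<le> (sqrt (real S) * (?Ms / \<theta> + \<theta> * ?zb / (?Ms * ?\<kappa>))) / ((1 - r) * real S)"
    using sumE rS by (intro divide_right_mono) auto
  also have "\<dots> = (?Ms / \<theta> + \<theta> * ?zb / (?Ms * ?\<kappa>)) / (1 - r) * (sqrt (real S) / real S)"
    by simp
  also have "sqrt (real S) / real S = 1 / sqrt (real S)"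
    using S by (simp add: real_div_sqrt divide_simps)
  finally show "expectation (\<lambda>w. (norm (da w - d))\<^sup>2) \<le> gap_const CARD('m) Cf \<delta> \<theta> r / sqrt (real S)"
    by (simp add: gap_const_def)
qed

text \<open>The dual inequality gives descent along \<open>d\<close> for each single objective. The
  deviation \<open>da - d\<close> costs its mean norm, hence the square root of the mean-square
  gap.\<close>

lemma inner_iter_expected_descent:
  assumes S: "0 < S"
  defines "d \<equiv> common_descent (\<lambda>i. g i x)"
    and "da \<equiv> \<lambda>w. fst (tail_average (\<lambda>_. step_size CARD('m) Cf \<delta> \<theta> S)
      (inner_iter Cf G (\<lambda>_. step_size CARD('m) Cf \<delta> \<theta> S) x (\<lambda>s. Y s w)) (nat \<lceil>r * real S\<rceil>) S)"
  shows "expectation (\<lambda>w. g i x \<bullet> da w)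
    \<le> - (norm d)\<^sup>2 + Cf * sqrt (gap_const CARD('m) Cf \<delta> \<theta> r / sqrt (real S))"
proof -
  have gap: "integrable M (\<lambda>w. (norm (da w - d))\<^sup>2)"
    "expectation (\<lambda>w. (norm (da w - d))\<^sup>2) \<le> gap_const CARD('m) Cf \<delta> \<theta> r / sqrt (real S)"
    and [measurable]: "da \<in> borel_measurable M" and daC: "norm (da w) \<le> Cf" for w
    unfolding d_def da_def by (rule inner_iter_tail_gap[OF S])+
  obtain l where dot: "\<And>i. g i x \<bullet> d \<le> - (norm d)\<^sup>2"
    unfolding d_def using common_descent_dual[of "\<lambda>i. g i x"] by metis
  have In: "integrable M (\<lambda>w. norm (da w - d))"
    using order_trans[OF norm_triangle_ineq4 add_right_mono[OF daC]]
    by (intro integrable_const_bound[where B="Cf + norm d"]) auto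
  have "expectation (\<lambda>w. g i x \<bullet> da w) \<le> expectation (\<lambda>w. - (norm d)\<^sup>2 + Cf * norm (da w - d))"
  proof (rule integral_mono)
    have "\<bar>g i x \<bullet> da w\<bar> \<le> norm (g i x) * Cf" for w
      using daC[of w] by (intro order_trans[OF Cauchy_Schwarz_ineq2] mult_left_mono) auto
    then show "integrable M (\<lambda>w. g i x \<bullet> da w)"
      by (intro integrable_const_bound[where B="norm (g i x) * Cf"]) auto
    show "integrable M (\<lambda>w. - (norm d)\<^sup>2 + Cf * norm (da w - d))"
      using In by simp
    fix w
    have "g i x \<bullet> da w = g i x \<bullet> d + g i x \<bullet> (da w - d)"
      by (simp add: inner_diff_right)
    also have "g i x \<bullet> (da w - d) \<le> norm (g i x) * norm (da w - d)"
      by (rule norm_cauchy_schwarz)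
    also have "\<dots> \<le> Cf * norm (da w - d)"
      by (intro mult_right_mono stoch_grad_moments(5)[OF sg]) simp
    finally show "g i x \<bullet> da w \<le> - (norm d)\<^sup>2 + Cf * norm (da w - d)"
      using dot[of i] by linarith
  qed
  also have "\<dots> = - (norm d)\<^sup>2 + Cf * expectation (\<lambda>w. norm (da w - d))"
    using In by (simp add: Bochner_Integration.integral_add prob_space)
  also have "expectation (\<lambda>w. norm (da w - d)) \<le> sqrt (expectation (\<lambda>w. (norm (da w - d))\<^sup>2))"
    by (rule expectation_le_sqrt[OF In gap(1)])
  also have "\<dots> \<le> sqrt (gap_const CARD('m) Cf \<delta> \<theta> r / sqrt (real S))"
    using gap(2) by (rule real_sqrt_le_mono)
  finally show ?thesis using Cf by simp
qed

end

end

section \<open>The outer loop\<close>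

context msmd_setting
begin

context
  fixes \<xi> :: "nat \<times> nat \<Rightarrow> 'w \<Rightarrow> 'x" and S :: "nat \<Rightarrow> nat" and \<alpha> :: "nat \<Rightarrow> real" and x0 :: "real^'n"
  assumes iid: "iid_samples M \<mu> \<xi>" and S: "\<And>k. 0 < S k" and \<alpha>: "\<And>k. 0 \<le> \<alpha> k"
begin

definition iterate :: "nat \<Rightarrow> 'w \<Rightarrow> real^'n" where
  "iterate k w = msmd Cf G S r (\<lambda>j _. step_size CARD('m) Cf \<delta> \<theta> (S j)) \<alpha> x0 (\<lambda>p. \<xi> p w) k"

text \<open>The outer point is a separate argument and only row \<open>k\<close> of \<open>X\<close>
  is read, so the point can be frozen while the row is redrawn.\<close>

definition row_direction :: "nat \<Rightarrow> real^'n \<Rightarrow> (nat \<times> nat \<Rightarrow> 'x) \<Rightarrow> real^'n" where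
  "row_direction k x X = fst (tail_average (\<lambda>_. step_size CARD('m) Cf \<delta> \<theta> (S k))
      (inner_iter Cf G (\<lambda>_. step_size CARD('m) Cf \<delta> \<theta> (S k)) x (\<lambda>s. X (k, s))) (nat \<lceil>r * real (S k)\<rceil>) (S k))"

lemma samples_measurable: "\<xi> p \<in> measurable M \<mu>"
  using iid by (cases p) (simp add: iid_samples_def indep_vars_def)

lemma iterate_Suc: "iterate (Suc k) w = iterate k w + \<alpha> k *\<^sub>R row_direction k (iterate k w) (\<lambda>p. \<xi> p w)"
  by (simp add: iterate_def row_direction_def)

lemma row_direction_cong:
  "(\<And>s. X (k, s) = X' (k, s)) \<Longrightarrow> row_direction k x X = row_direction k x X'"
  by (simp add: row_direction_def)

lemma norm_row_direction_le: "norm (row_direction k x X) \<le> Cf"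
proof -
  have "norm (fst (inner_iter Cf G (\<lambda>_. step_size CARD('m) Cf \<delta> \<theta> (S k)) x (\<lambda>s. X (k, s)) s)) \<le> Cf" for s
    using inner_iter_feasible[where \<gamma>="\<lambda>_. step_size CARD('m) Cf \<delta> \<theta> (S k)" and x=x and X="\<lambda>s. X (k, s)" and s=s]
    by (auto simp: feasible_def)
  then show ?thesis
    unfolding row_direction_def using step_size_pos[OF S, of k] nat_ceiling_le[of "S k"]
    by (intro norm_fst_tail_average_le) auto
qed

lemma row_direction_measurable:
  assumes "x \<in> borel_measurable N" "\<And>s. (\<lambda>w. X w (k, s)) \<in> measurable N \<mu>"
  shows "(\<lambda>w. row_direction k (x w) (X w)) \<in> borel_measurable N"
  unfolding row_direction_def using assms
  by (intro borel_measurable_fst_tail_average borel_measurable_inner_iter[OF m Cf G]) auto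

lemma iterate_measurable: "iterate k \<in> borel_measurable M"
  unfolding iterate_def[abs_def] using samples_measurable by (intro borel_measurable_msmd[OF m Cf G]) auto

text \<open>Each outer step has length at most \<open>\<alpha> k * Cf\<close>, on every sample path.
  Hence continuous functions of an iterate are integrable without growth conditions.\<close>

lemma iterate_bounded: "\<exists>R. \<forall>w. norm (iterate k w) \<le> R"
proof (induction k)
  case 0
  show ?case by (auto simp: iterate_def)
next
  case (Suc k)
  then obtain R where R: "\<And>w. norm (iterate k w) \<le> R" by blast
  have "norm (iterate (Suc k) w) \<le> R + \<alpha> k * Cf" for w
    unfolding iterate_Suc using R norm_row_direction_le \<alpha>
    by (intro order_trans[OF norm_triangle_ineq] add_mono) (auto intro!: mult_left_mono)
  then show ?case by blast
qed

lemma integrable_continuous_iterate: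
  fixes \<phi> :: "real^'n \<Rightarrow> real"
  assumes \<phi>: "continuous_on UNIV \<phi>"
  shows "integrable M (\<lambda>w. \<phi> (iterate k w))"
proof -
  obtain R where R: "\<And>w. norm (iterate k w) \<le> R" using iterate_bounded by blast
  have "compact (\<phi> ` cball 0 R)"
    using \<phi> by (intro compact_continuous_image) (auto intro: continuous_on_subset)
  then obtain B where B: "\<And>y. norm y \<le> R \<Longrightarrow> norm (\<phi> y) \<le> B"
    by (fastforce dest!: compact_imp_bounded simp: bounded_iff)
  have "(\<lambda>w. \<phi> (iterate k w)) \<in> borel_measurable M"
    by (rule measurable_compose[OF iterate_measurable borel_measurable_continuous_onI[OF \<phi>]])
  then show ?thesis
    using R B by (intro integrable_const_bound[where B=B]) auto
qed

lemma continuous_f: "continuous_on UNIV (f i)"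
  using grad by (auto simp: gderiv_def intro!: has_derivative_continuous continuous_at_imp_continuous_on)

lemma continuous_g: "continuous_on UNIV (g i)"
  using lip by (rule lipschitz_on_continuous_on)

lemma integrable_descent_sq: "integrable M (\<lambda>w. (norm (common_descent (\<lambda>i. g i (iterate k w))))\<^sup>2)"
  by (rule integrable_continuous_iterate[of "\<lambda>x. (norm (common_descent (\<lambda>i. g i x)))\<^sup>2"])
    (intro continuous_on_power continuous_on_norm_common_descent[OF lip])

text \<open>Rows before \<open>k\<close> determine the iterate and row \<open>k\<close> is
  independent of them, so the estimate at a deterministic point can be integrated over the law of
  the iterate.\<close>

lemma expected_direction:
  assumes sg: "AE w in M. stoch_grad \<mu> g G Cf \<delta> (iterate k w)"
  shows "integrable M (\<lambda>w. g i (iterate k w) \<bullet> row_direction k (iterate k w) (\<lambda>p. \<xi> p w))"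
    and "expectation (\<lambda>w. g i (iterate k w) \<bullet> row_direction k (iterate k w) (\<lambda>p. \<xi> p w))
      \<le> - expectation (\<lambda>w. (norm (common_descent (\<lambda>i. g i (iterate k w))))\<^sup>2)
        + Cf * sqrt (gap_const CARD('m) Cf \<delta> \<theta> r / sqrt (real (S k)))"
proof -
  define A where "A = {..<k} \<times> (UNIV :: nat set)"
  define B where "B = {k} \<times> (UNIV :: nat set)"
  define PA where "PA = PiM A (\<lambda>_. \<mu>)"
  define PB where "PB = PiM B (\<lambda>_. \<mu>)"
  define X0 where "X0 w = restrict (\<lambda>p. \<xi> p w) A" for w
  define Y0 where "Y0 w = restrict (\<lambda>p. \<xi> p w) B" for w
  define \<phi> where "\<phi> X = msmd Cf G S r (\<lambda>j _. step_size CARD('m) Cf \<delta> \<theta> (S j)) \<alpha> x0 X k" for X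
  define h where "h = (\<lambda>(X, X'). g i (\<phi> X) \<bullet> row_direction k (\<phi> X) X')"
  have gm[measurable]: "g i \<in> borel_measurable borel"
    by (rule borel_measurable_continuous_onI[OF continuous_g])
  have ivs: "indep_vars (\<lambda>_. \<mu>) \<xi> UNIV" using iid by (simp add: iid_samples_def)
  have ind: "indep_var PA X0 PB Y0"
    unfolding PA_def PB_def X0_def[abs_def] Y0_def[abs_def]
    by (rule indep_var_restrict[OF ivs]) (auto simp: A_def B_def)
  have "\<phi> \<in> borel_measurable PA"
    unfolding \<phi>_def PA_def by (rule borel_measurable_msmd[OF m Cf G]) (auto simp: A_def)
  then have \<phi>1[measurable]: "(\<lambda>p. \<phi> (fst p)) \<in> borel_measurable (PA \<Otimes>\<^sub>M PB)" by measurable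
  have "(\<lambda>p. row_direction k (\<phi> (fst p)) (snd p)) \<in> borel_measurable (PA \<Otimes>\<^sub>M PB)"
  proof (rule row_direction_measurable[OF \<phi>1])
    fix s
    have "(k, s) \<in> B" by (simp add: B_def)
    then show "(\<lambda>p. snd p (k, s)) \<in> measurable (PA \<Otimes>\<^sub>M PB) \<mu>"
      unfolding PB_def by measurable
  qed
  then have h: "h \<in> borel_measurable (PA \<Otimes>\<^sub>M PB)"
    unfolding h_def case_prod_beta by measurable
  have \<phi>X: "\<phi> (X0 w) = iterate k w" for w
    unfolding \<phi>_def X0_def iterate_def by (rule msmd_cong) (simp add: A_def)
  have hw: "h (X0 w, Y0 w') = g i (iterate k w) \<bullet> row_direction k (iterate k w) (\<lambda>p. \<xi> p w')" for w w'
    unfolding h_def prod.case \<phi>X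
    by (intro arg_cong2[where f=inner] refl row_direction_cong) (simp add: Y0_def B_def)
  have Ig: "integrable M (\<lambda>w. norm (g i (iterate k w)) * Cf)"
    by (intro integrable_mult_left integrable_continuous_iterate[of "\<lambda>x. norm (g i x)"] continuous_on_norm continuous_g)
  have bd: "\<bar>g i y \<bullet> row_direction k y X\<bar> \<le> norm (g i y) * Cf" for y X
    using norm_row_direction_le by (intro order_trans[OF Cauchy_Schwarz_ineq2] mult_left_mono) auto
  have [measurable]: "(\<lambda>w. row_direction k (iterate k w) (\<lambda>p. \<xi> p w)) \<in> borel_measurable M"
    by (rule row_direction_measurable[OF iterate_measurable samples_measurable])
  note iterate_measurable[measurable]
  show I: "integrable M (\<lambda>w. g i (iterate k w) \<bullet> row_direction k (iterate k w) (\<lambda>p. \<xi> p w))"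
    by (rule Bochner_Integration.integrable_bound[OF Ig])
      (use bd Cf in \<open>auto simp: abs_mult\<close>)
  note it = indep_var_integral_iterated[OF ind h, unfolded hw, OF I]
  \<comment> \<open>Independence within row \<open>k\<close>, obtained by regrouping the samples
    into singleton blocks and evaluating each block at its only index.\<close>
  have "indep_vars (\<lambda>s. PiM {(k, s)} (\<lambda>_. \<mu>)) (\<lambda>s w. restrict (\<lambda>p. \<xi> p w) {(k, s)}) UNIV"
    by (rule indep_vars_restrict[OF ivs]) (auto simp: disjoint_family_on_def)
  then have row: "indep_vars (\<lambda>_. \<mu>) (\<lambda>s. \<xi> (k, s)) UNIV"
    using indep_vars_compose2[where Y="\<lambda>s X. X (k, s)" and N="\<lambda>_. \<mu>"] by fastforce
  have inner: "expectation (\<lambda>w'. g i (iterate k w) \<bullet> row_direction k (iterate k w) (\<lambda>p. \<xi> p w'))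
      \<le> - (norm (common_descent (\<lambda>i. g i (iterate k w))))\<^sup>2
        + Cf * sqrt (gap_const CARD('m) Cf \<delta> \<theta> r / sqrt (real (S k)))"
    if "stoch_grad \<mu> g G Cf \<delta> (iterate k w)" for w
    unfolding row_direction_def
    using iid by (intro inner_iter_expected_descent[OF that row _ S]) (simp add: iid_samples_def)
  have "expectation (\<lambda>w. g i (iterate k w) \<bullet> row_direction k (iterate k w) (\<lambda>p. \<xi> p w))
      \<le> expectation (\<lambda>w. - (norm (common_descent (\<lambda>i. g i (iterate k w))))\<^sup>2
        + Cf * sqrt (gap_const CARD('m) Cf \<delta> \<theta> r / sqrt (real (S k))))"
    unfolding it(2)
    by (rule integral_mono_AE[OF it(1)]) (use integrable_descent_sq sg inner in auto)
  also have "\<dots> = - expectation (\<lambda>w. (norm (common_descent (\<lambda>i. g i (iterate k w))))\<^sup>2)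
        + Cf * sqrt (gap_const CARD('m) Cf \<delta> \<theta> r / sqrt (real (S k)))"
    using integrable_descent_sq[of k] by (simp add: Bochner_Integration.integral_diff prob_space)
  finally show "expectation (\<lambda>w. g i (iterate k w) \<bullet> row_direction k (iterate k w) (\<lambda>p. \<xi> p w)) \<le> \<dots>" .
qed

lemma expected_descent_step:
  assumes sg: "AE w in M. stoch_grad \<mu> g G Cf \<delta> (iterate k w)"
  shows "expectation (\<lambda>w. f i (iterate (Suc k) w)) \<le> expectation (\<lambda>w. f i (iterate k w))
    + \<alpha> k * (- expectation (\<lambda>w. (norm (common_descent (\<lambda>i. g i (iterate k w))))\<^sup>2)
        + Cf * sqrt (gap_const CARD('m) Cf \<delta> \<theta> r / sqrt (real (S k))))
    + L * (\<alpha> k)\<^sup>2 * Cf\<^sup>2"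
proof -
  have L: "0 \<le> L" using lip lipschitz_on_nonneg by blast
  note If = integrable_continuous_iterate[OF continuous_f[of i]]
  let ?e = "\<lambda>w. g i (iterate k w) \<bullet> row_direction k (iterate k w) (\<lambda>p. \<xi> p w)"
  have "expectation (\<lambda>w. f i (iterate (Suc k) w)) \<le> expectation (\<lambda>w. f i (iterate k w) + \<alpha> k * ?e w + L * (\<alpha> k)\<^sup>2 * Cf\<^sup>2)"
  proof (rule integral_mono)
    show "integrable M (\<lambda>w. f i (iterate k w) + \<alpha> k * ?e w + L * (\<alpha> k)\<^sup>2 * Cf\<^sup>2)"
      using If expected_direction(1)[OF sg] by simp
    fix w
    have "(norm (\<alpha> k *\<^sub>R row_direction k (iterate k w) (\<lambda>p. \<xi> p w)))\<^sup>2 \<le> (\<alpha> k * Cf)\<^sup>2"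
      using \<alpha>[of k] norm_row_direction_le by (intro power_mono) (auto intro: mult_left_mono)
    then have "L * (norm (\<alpha> k *\<^sub>R row_direction k (iterate k w) (\<lambda>p. \<xi> p w)))\<^sup>2 \<le> L * (\<alpha> k * Cf)\<^sup>2"
      using L by (rule mult_left_mono)
    then show "f i (iterate (Suc k) w) \<le> f i (iterate k w) + \<alpha> k * ?e w + L * (\<alpha> k)\<^sup>2 * Cf\<^sup>2"
      using lipschitz_gradient_descent[OF grad lip, of i "iterate k w" "\<alpha> k *\<^sub>R row_direction k (iterate k w) (\<lambda>p. \<xi> p w)"]
      by (simp add: iterate_Suc power_mult_distrib mult.assoc)
  qed (rule If)
  also have "\<dots> = expectation (\<lambda>w. f i (iterate k w)) + \<alpha> k * expectation ?e + L * (\<alpha> k)\<^sup>2 * Cf\<^sup>2"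
    using If expected_direction(1)[OF sg] by (simp add: Bochner_Integration.integral_add prob_space)
  also have "\<dots> \<le> expectation (\<lambda>w. f i (iterate k w))
    + \<alpha> k * (- expectation (\<lambda>w. (norm (common_descent (\<lambda>i. g i (iterate k w))))\<^sup>2)
        + Cf * sqrt (gap_const CARD('m) Cf \<delta> \<theta> r / sqrt (real (S k))))
    + L * (\<alpha> k)\<^sup>2 * Cf\<^sup>2"
    using \<alpha> by (intro add_right_mono add_left_mono mult_left_mono expected_direction(2)[OF sg]) auto
  finally show ?thesis .
qed

text \<open>Telescoping the expected values of one objective; the lower bound \<open>Finf\<close>
  enters at the final iterate.\<close>

lemma expected_descent_sum:
  assumes sg: "\<And>k. k < K \<Longrightarrow> AE w in M. stoch_grad \<mu> g G Cf \<delta> (iterate k w)"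
    and lo: "Finf \<le> expectation (\<lambda>w. f i (iterate K w))"
  shows "(\<Sum>k<K. \<alpha> k * expectation (\<lambda>w. (norm (common_descent (\<lambda>i. g i (iterate k w))))\<^sup>2))
    \<le> f i x0 - Finf + (\<Sum>k<K. \<alpha> k * (Cf * sqrt (gap_const CARD('m) Cf \<delta> \<theta> r / sqrt (real (S k)))) + L * (\<alpha> k)\<^sup>2 * Cf\<^sup>2)"
proof -
  let ?D = "\<lambda>k. \<alpha> k * expectation (\<lambda>w. (norm (common_descent (\<lambda>i. g i (iterate k w))))\<^sup>2)"
  let ?e = "\<lambda>k. \<alpha> k * (Cf * sqrt (gap_const CARD('m) Cf \<delta> \<theta> r / sqrt (real (S k)))) + L * (\<alpha> k)\<^sup>2 * Cf\<^sup>2"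
  let ?F = "\<lambda>k. expectation (\<lambda>w. f i (iterate k w))"
  have "(\<Sum>k<K. ?D k) \<le> (\<Sum>k<K. (?F k - ?F (Suc k)) + ?e k)"
  proof (rule sum_mono)
    fix k assume "k \<in> {..<K}"
    then show "?D k \<le> (?F k - ?F (Suc k)) + ?e k"
      using expected_descent_step[OF sg, of k i] by (simp add: algebra_simps)
  qed
  also have "\<dots> = ?F 0 - ?F K + (\<Sum>k<K. ?e k)"
    unfolding sum.distrib[of "\<lambda>k. ?F k - ?F (Suc k)" ?e] using sum_lessThan_telescope'[of ?F K] by simp
  also have "?F 0 = f i x0" by (simp add: iterate_def prob_space)
  finally show ?thesis using lo by linarith
qed

end

end

text \<open>The error of one outer step when \<open>sqrt (S k) = k + 1\<close>. It dominates both
  inner schedules and is free of \<open>K\<close>, so its series bounds all partial sums.\<close>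

definition outer_error :: "real \<Rightarrow> real \<Rightarrow> real \<Rightarrow> real \<Rightarrow> nat \<Rightarrow> real" where
  "outer_error L Cf \<rho> B k =
     \<rho> / (real k + 1) * (Cf * sqrt (B / (real k + 1))) + L * (\<rho> / (real k + 1))\<^sup>2 * Cf\<^sup>2"

lemma summable_shifted_powr: "s < - 1 \<Longrightarrow> summable (\<lambda>k. (real k + 1) powr s)"
  using summable_real_powr_iff[of s] summable_Suc_iff[of "\<lambda>k. real k powr s"]
  by (simp add: add.commute)

lemma summable_outer_error: "summable (outer_error L Cf \<rho> B)"
proof -
  have "outer_error L Cf \<rho> B = (\<lambda>k. \<rho> * Cf * sqrt B * (real k + 1) powr (- 3 / 2)
    + L * \<rho>\<^sup>2 * Cf\<^sup>2 * (real k + 1) powr (- 2))"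
  proof
    fix k :: nat
    define y where "y = real k + 1"
    have y: "0 < y" by (simp add: y_def)
    have "y powr (- 3 / 2) = y powr (- 1) * y powr (- (1 / 2))"
      by (subst powr_add[symmetric]) simp
    also have "\<dots> = 1 / (y * sqrt y)"
      using y by (simp add: powr_minus powr_half_sqrt divide_simps)
    finally have "y powr (- 3 / 2) = 1 / (y * sqrt y)" .
    moreover have "y powr (- 2) = 1 / y\<^sup>2"
      using y by (simp add: powr_minus divide_simps)
    ultimately show "outer_error L Cf \<rho> B k = \<rho> * Cf * sqrt B * (real k + 1) powr (- 3 / 2)
      + L * \<rho>\<^sup>2 * Cf\<^sup>2 * (real k + 1) powr (- 2)"
      unfolding outer_error_def y_def[symmetric]
      by (simp add: real_sqrt_divide power_divide)
  qed
  then show ?thesis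
    by (simp add: summable_add summable_mult summable_shifted_powr)
qed

lemma outer_error_nonneg:
  "0 \<le> L \<Longrightarrow> 0 \<le> Cf \<Longrightarrow> 0 \<le> \<rho> \<Longrightarrow> 0 \<le> B \<Longrightarrow> 0 \<le> outer_error L Cf \<rho> B k"
  by (simp add: outer_error_def)

context msmd_setting
begin

text \<open>The second bound is uniform in \<open>K\<close>. The first keeps the actual
  \<open>S\<close> and is also applied to the first step of a longer run, where many inner steps
  make the error small.\<close>

lemma weighted_descent_le:
  fixes \<xi> :: "nat \<times> nat \<Rightarrow> 'w \<Rightarrow> 'x" and x :: "nat \<Rightarrow> 'w \<Rightarrow> real^'n"
  assumes iid: "iid_samples M \<mu> \<xi>" and S0: "\<And>k. 0 < S k" and S: "\<And>k. k < K \<Longrightarrow> (k + 1)\<^sup>2 \<le> S k" and \<rho>: "0 < \<rho>"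
    and x: "\<And>k w. x k w = msmd Cf G S r (\<lambda>j _. \<theta> / (Mstar CARD('m) Cf \<delta> * sqrt (real (S j))))
        (\<lambda>k. \<rho> / (real k + 1)) x0 (\<lambda>p. \<xi> p w) k"
    and it: "\<And>k. k \<le> K \<Longrightarrow> iterate_assms M \<mu> f g G Cf \<delta> Finf (x k)"
  shows "(\<Sum>k<K. \<rho> / (real k + 1) * (\<integral>w. (norm (common_descent (\<lambda>i. g i (x k w))))\<^sup>2 \<partial>M))
    \<le> f i x0 - Finf
      + (\<Sum>k<K. \<rho> / (real k + 1) * (Cf * sqrt (gap_const CARD('m) Cf \<delta> \<theta> r / sqrt (real (S k))))
          + L * (\<rho> / (real k + 1))\<^sup>2 * Cf\<^sup>2)"
    and "(\<Sum>k<K. \<rho> / (real k + 1) * (\<integral>w. (norm (common_descent (\<lambda>i. g i (x k w))))\<^sup>2 \<partial>M))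
    \<le> f i x0 - Finf + suminf (outer_error L Cf \<rho> (gap_const CARD('m) Cf \<delta> \<theta> r))"
proof -
  define \<alpha> where "\<alpha> k = \<rho> / (real k + 1)" for k
  let ?B = "gap_const CARD('m) Cf \<delta> \<theta> r"
  have \<alpha>0: "0 \<le> \<alpha> k" for k using \<rho> by (simp add: \<alpha>_def)
  have xi: "x k = iterate \<xi> S \<alpha> x0 k" for k
    by (rule ext) (simp only: x iterate_def[OF iid S0 \<alpha>0] step_size_def, simp only: \<alpha>_def[abs_def])
  have B: "0 \<le> ?B" by (rule gap_const_nonneg)
  have L: "0 \<le> L" using lip lipschitz_on_nonneg by blast
  have "(\<Sum>k<K. \<alpha> k * (\<integral>w. (norm (common_descent (\<lambda>i. g i (x k w))))\<^sup>2 \<partial>M))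
    \<le> f i x0 - Finf + (\<Sum>k<K. \<alpha> k * (Cf * sqrt (?B / sqrt (real (S k)))) + L * (\<alpha> k)\<^sup>2 * Cf\<^sup>2)"
    unfolding xi
    by (rule expected_descent_sum[OF iid S0 \<alpha>0]) (use it in \<open>auto simp: iterate_assms_def xi\<close>)
  then show 1: "(\<Sum>k<K. \<rho> / (real k + 1) * (\<integral>w. (norm (common_descent (\<lambda>i. g i (x k w))))\<^sup>2 \<partial>M))
    \<le> f i x0 - Finf
      + (\<Sum>k<K. \<rho> / (real k + 1) * (Cf * sqrt (?B / sqrt (real (S k)))) + L * (\<rho> / (real k + 1))\<^sup>2 * Cf\<^sup>2)"
    by (simp only: \<alpha>_def)
  have "(\<Sum>k<K. \<rho> / (real k + 1) * (Cf * sqrt (?B / sqrt (real (S k)))) + L * (\<rho> / (real k + 1))\<^sup>2 * Cf\<^sup>2)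
      \<le> (\<Sum>k<K. outer_error L Cf \<rho> ?B k)"
    unfolding outer_error_def
  proof (intro sum_mono add_right_mono mult_left_mono real_sqrt_le_mono divide_left_mono)
    fix k assume "k \<in> {..<K}"
    then have "real ((k + 1)\<^sup>2) \<le> real (S k)" using S by (intro of_nat_mono) auto
    then show "real k + 1 \<le> sqrt (real (S k))"
      by (intro real_le_rsqrt) (simp add: add.commute)
    then show "0 < sqrt (real (S k)) * (real k + 1)" using S0[of k] by simp
  qed (use B Cf \<rho> in auto)
  also have "\<dots> \<le> suminf (outer_error L Cf \<rho> ?B)"
    using summable_outer_error[of L Cf \<rho> ?B] outer_error_nonneg[OF L _ _ B] Cf \<rho> by (intro sum_le_suminf) auto
  finally show "(\<Sum>k<K. \<rho> / (real k + 1) * (\<integral>w. (norm (common_descent (\<lambda>i. g i (x k w))))\<^sup>2 \<partial>M))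
    \<le> f i x0 - Finf + suminf (outer_error L Cf \<rho> ?B)"
    using 1 by linarith
qed

text \<open>The summand 2 in \<open>M1\<close> keeps it positive for every \<open>D\<close>; this
  yields a positive entry of the maximum in (b).\<close>

lemma M1_pos: "0 < M1 CARD('m) Cf \<delta> \<theta> r D S"
proof -
  have "\<lceil>r * real S\<rceil> \<le> int S" using nat_ceiling_le[of S] by (simp only: nat_le_iff)
  then have "0 \<le> 2 * D\<^sup>2 * real S / (real S - of_int \<lceil>r * real S\<rceil> + 1)"
    by (intro divide_nonneg_nonneg) (simp, linarith)
  then show ?thesis
    unfolding M1_def using Mstar_pos \<theta> by (intro mult_pos_pos) (auto simp: less_max_iff_disj)
qed

end

theorem corollary4p3:
  fixes f :: "'m::finite \<Rightarrow> real^'n \<Rightarrow> real"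
    and g :: "'m \<Rightarrow> real^'n \<Rightarrow> real^'n"
    and G :: "'m \<Rightarrow> real^'n \<Rightarrow> 'x \<Rightarrow> real^'n"
    and \<mu> :: "'x measure"
    and M :: "'w measure"
    and \<xi> :: "nat \<Rightarrow> nat \<times> nat \<Rightarrow> 'w \<Rightarrow> 'x"
    and \<xi>' :: "nat \<times> nat \<Rightarrow> 'w \<Rightarrow> 'x"
    and x0 :: "real^'n"
    and L Cf \<delta> \<theta> \<rho> r Finf Mf :: real
    and \<alpha> :: "nat \<Rightarrow> real"
    and \<gamma> :: "nat \<Rightarrow> real"
    and A :: "nat \<Rightarrow> real"
    and xa :: "nat \<Rightarrow> nat \<Rightarrow> 'w \<Rightarrow> real^'n"
    and xb :: "nat \<Rightarrow> 'w \<Rightarrow> real^'n"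
  assumes m: "2 \<le> CARD('m)"
    and grad: "\<And>i x. GDERIV (f i) x :> g i x"
    and lip: "\<And>i. L-lipschitz_on UNIV (g i)"
    and Cf: "0 < Cf" and \<delta>: "0 \<le> \<delta>"
    and \<theta>: "0 < \<theta>" and \<rho>: "0 < \<rho>" and r: "0 < r" "r < 1"
    and \<mu>: "prob_space \<mu>"
    and G: "\<And>i. (\<lambda>(x, y). G i x y) \<in> borel_measurable (borel \<Otimes>\<^sub>M \<mu>)"
    and M: "prob_space M"
  defines "\<alpha> \<equiv> \<lambda>k. \<rho> / (real k + 1)"
    and "A \<equiv> \<lambda>K. \<Sum>k<K. \<alpha> k"
    and "\<gamma> \<equiv> \<lambda>S. \<theta> / (Mstar CARD('m) Cf \<delta> * sqrt (real S))"
    and "Mf \<equiv> (MAX i. f i x0) - Finf"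
    \<comment> \<open>iterate \<open>k\<close> of the run with \<open>K\<close> outer iterations and \<open>(K+1)\<^sup>2\<close> inner steps in each\<close>
    and "xa \<equiv> \<lambda>K k w. msmd Cf G (\<lambda>_. (K + 1)\<^sup>2) r (\<lambda>_ _. \<gamma> ((K + 1)\<^sup>2)) \<alpha> x0 (\<lambda>p. \<xi> K p w) k"
    \<comment> \<open>iterate \<open>k\<close> of the run with \<open>(k+1)\<^sup>2\<close> inner steps at outer iteration \<open>k\<close>\<close>
    and "xb \<equiv> \<lambda>k w. msmd Cf G (\<lambda>j. (j + 1)\<^sup>2) r (\<lambda>j _. \<gamma> ((j + 1)\<^sup>2)) \<alpha> x0 (\<lambda>p. \<xi>' p w) k"
  shows
    "((\<forall>K\<ge>1. iid_samples M \<mu> (\<xi> K)) \<and>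
      (\<forall>K\<ge>1. \<forall>k\<le>K. iterate_assms M \<mu> f g G Cf \<delta> Finf (xa K k))
      \<longrightarrow> (\<exists>c>0. \<forall>K\<ge>1.
       1 / A K * (\<Sum>k<K. \<alpha> k * (\<integral>w. (norm (common_descent (\<lambda>i. g i (xa K k w))))\<^sup>2 \<partial>M))
         \<le> c * (max (L * real CARD('m) * Cf\<^sup>2 * \<rho> * pi\<^sup>2 / 3) (2 * Mf / \<rho>) / ln (real K + 1))))
    \<and>
     (iid_samples M \<mu> \<xi>' \<and>
      (\<forall>k. iterate_assms M \<mu> f g G Cf \<delta> Finf (xb k))
      \<longrightarrow> (\<forall>D\<ge>0. ereal D \<le> bregman_diam (omega Cf) (feasible Cf :: ((real^'n) \<times> (real^'m)) set)
      \<longrightarrow> (\<exists>c>0. \<forall>K\<ge>1.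
       (let M\<^sub>1 = (MAX k\<in>{..<K}. M1 CARD('m) Cf \<delta> \<theta> r D ((k + 1)\<^sup>2)) in
       1 / A K * (\<Sum>k<K. \<alpha> k * (\<integral>w. (norm (common_descent (\<lambda>i. g i (xb k w))))\<^sup>2 \<partial>M))
         \<le> c * (Max {L * real CARD('m) * Cf\<^sup>2 * \<rho> * pi\<^sup>2 / 3,
                     2 * (\<Sum>k. 1 / (real k + 1) powr (3 / 2)) * Cf * sqrt M\<^sub>1,
                     2 * (\<Sum>k. 1 / (real k + 1) ^ 3) * L * \<rho> * M\<^sub>1,
                     2 * Mf / \<rho>} * (1 / ln (real K + 1)))))))"
proof -
  interpret msmd_setting M f g G \<mu> L Cf \<delta> \<theta> r
    by (rule msmd_setting.intro[OF M msmd_setting_axioms.intro]) (fact m grad lip Cf \<theta> r \<mu> G)+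
  let ?B = "gap_const CARD('m) Cf \<delta> \<theta> r"
  have L: "0 \<le> L" using lip lipschitz_on_nonneg by blast
  define E where "E = suminf (outer_error L Cf \<rho> ?B)"
  \<comment> \<open>\<open>A K\<close> is \<open>\<rho>\<close> times a harmonic number, which is
    the source of the logarithm.\<close>
  have A: "\<rho> * ln (real K + 1) \<le> A K" for K
  proof -
    have "A K = \<rho> * harm K"
      unfolding A_def \<alpha>_def harm_def
      by (simp add: sum_distrib_left sum.atLeast1_atMost_eq divide_inverse add.commute)
    then show ?thesis using \<rho> ln_le_harm[of K] by simp
  qed
  have average_le: "1 / A K * s \<le> C / (\<rho> * ln (real K + 1))" if "0 \<le> s" "s \<le> C" "1 \<le> K" for s C K
  proof -
    have "0 < \<rho> * ln (real K + 1)" using \<rho> that by simp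
    then have "s / A K \<le> C / (\<rho> * ln (real K + 1))" using that A[of K] by (intro frac_le) auto
    then show ?thesis by simp
  qed
  have nonneg: "0 \<le> (\<Sum>k<K. \<alpha> k * (\<integral>w. (norm (common_descent (\<lambda>i. g i (x k w))))\<^sup>2 \<partial>M))"
    for K and x :: "nat \<Rightarrow> 'w \<Rightarrow> real^'n"
    using \<rho> by (intro sum_nonneg mult_nonneg_nonneg Bochner_Integration.integral_nonneg) (auto simp: \<alpha>_def)
  have f_le: "f i x0 - Finf \<le> Mf" for i by (simp add: Mf_def)
  show ?thesis
  proof (intro conjI impI allI)
    assume "(\<forall>K\<ge>1. iid_samples M \<mu> (\<xi> K)) \<and> (\<forall>K\<ge>1. \<forall>k\<le>K. iterate_assms M \<mu> f g G Cf \<delta> Finf (xa K k))"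
    then have iid: "\<And>K. 1 \<le> K \<Longrightarrow> iid_samples M \<mu> (\<xi> K)"
      and it: "\<And>K k. 1 \<le> K \<Longrightarrow> k \<le> K \<Longrightarrow> iterate_assms M \<mu> f g G Cf \<delta> Finf (xa K k)" by auto
    define mx where "mx = max (L * real CARD('m) * Cf\<^sup>2 * \<rho> * pi\<^sup>2 / 3) (2 * Mf / \<rho>)"
    define D where "D K = (\<Sum>k<K. \<alpha> k * (\<integral>w. (norm (common_descent (\<lambda>i. g i (xa K k w))))\<^sup>2 \<partial>M))" for K
    have D0: "0 \<le> D K" for K unfolding D_def by (rule nonneg)
    \<comment> \<open>The constant schedule is written as a function applied to \<open>j\<close>, to
      match the \<open>S j\<close> of \<open>weighted_descent_le\<close>.\<close>
    have xa: "xa K k w = msmd Cf G (\<lambda>_. (K + 1)\<^sup>2) r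
        (\<lambda>j _. \<theta> / (Mstar CARD('m) Cf \<delta> * sqrt (real ((\<lambda>_. (K + 1)\<^sup>2) j))))
        (\<lambda>k. \<rho> / (real k + 1)) x0 (\<lambda>p. \<xi> K p w) k" for K k w
      by (simp only: xa_def \<gamma>_def \<alpha>_def)
    have S: "0 < (K + 1)\<^sup>2" "k < K \<Longrightarrow> (k + 1)\<^sup>2 \<le> (K + 1)\<^sup>2" for k K :: nat
      by (auto intro: power_mono)
    have DE: "D K \<le> Mf + E" if K: "1 \<le> K" for K
      using weighted_descent_le(2)[where \<xi>="\<xi> K" and S="\<lambda>_. (K + 1)\<^sup>2" and x="xa K" and K=K,
          OF iid[OF K] S \<rho> xa it[OF K]] f_le
      unfolding D_def \<alpha>_def E_def by (meson add_right_mono order_trans)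
    have "\<exists>c>0. \<forall>K\<ge>1. 1 / A K * D K \<le> c * (mx / ln (real K + 1))"
    proof (cases "0 < mx")
      case True
      have C: "0 < Mf + E + 1" using DE[of 1] D0[of 1] by simp
      show ?thesis
      \<comment> \<open>Here \<open>mx\<close> is a positive constant free of \<open>K\<close>, so
        dividing by it is harmless; the added 1 makes the witness positive.\<close>
      proof (intro exI[of _ "(Mf + E + 1) / (\<rho> * mx)"] conjI allI impI)
        show "0 < (Mf + E + 1) / (\<rho> * mx)" using C True \<rho> by simp
        fix K :: nat assume K: "1 \<le> K"
        have "1 / A K * D K \<le> (Mf + E + 1) / (\<rho> * ln (real K + 1))"
          using DE[OF K] by (intro average_le D0 K) simp
        also have "\<dots> = (Mf + E + 1) / (\<rho> * mx) * (mx / ln (real K + 1))"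
          using True by simp
        finally show "1 / A K * D K \<le> (Mf + E + 1) / (\<rho> * mx) * (mx / ln (real K + 1))" .
      qed
    next
      case False
      have mx0: "L * real CARD('m) * Cf\<^sup>2 * \<rho> * pi\<^sup>2 / 3 \<le> 0" "2 * Mf / \<rho> \<le> 0"
        using False by (auto simp: mx_def)
      have L0: "L = 0"
      proof (rule ccontr)
        assume "L \<noteq> 0"
        then have "0 < L * real CARD('m) * Cf\<^sup>2 * \<rho> * pi\<^sup>2 / 3"
          using L Cf \<rho> by simp
        then show False using mx0(1) by linarith
      qed
      have Mf0: "Mf \<le> 0" using mx0(2) \<rho> by (simp add: divide_le_0_iff)
      let ?d = "common_descent (\<lambda>i. g i x0)"
      have small: "(norm ?d)\<^sup>2 \<le> Cf * sqrt (?B / real (Suc K))" if K: "1 \<le> K" for K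
      proof -
        have xa0: "xa K 0 w = x0" for w by (simp add: xa)
        have "sqrt (real ((K + 1)\<^sup>2)) = real (Suc K)"
          unfolding of_nat_power by (simp add: real_sqrt_abs)
        \<comment> \<open>Only the first outer step of run \<open>K\<close> is used: its step size
          is \<open>\<rho>\<close>, its starting point is the deterministic \<open>x0\<close>, and
          it makes \<open>(K + 1)\<^sup>2\<close> inner steps.\<close>
        then have *: "\<rho> * (norm ?d)\<^sup>2 \<le> f i x0 - Finf + \<rho> * (Cf * sqrt (?B / real (Suc K)))" for i
          using weighted_descent_le(1)[where \<xi>="\<xi> K" and S="\<lambda>_. (K + 1)\<^sup>2" and x="xa K" and K=1 and i=i,
              OF iid[OF K] S(1) _ \<rho> xa it[OF K]] K L0
          by (simp add: xa0 prob_space del: of_nat_Suc)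
        \<comment> \<open>\<open>undefined\<close> stands for an arbitrary objective index.\<close>
        have "\<rho> * (norm ?d)\<^sup>2 \<le> \<rho> * (Cf * sqrt (?B / real (Suc K)))"
          using *[of undefined] Mf0 f_le[of undefined] by linarith
        then show ?thesis using \<rho> by simp
      qed
      \<comment> \<open>The left side of \<open>small\<close> does not involve \<open>K\<close>, so
        letting the run index grow removes the inner error.\<close>
      have "(\<lambda>K. Cf * sqrt (?B / real (Suc K))) \<longlonglongrightarrow> Cf * sqrt 0"
        by (intro tendsto_intros LIMSEQ_Suc[OF lim_const_over_n])
      then have "(norm ?d)\<^sup>2 \<le> Cf * sqrt 0"
        by (rule LIMSEQ_le_const) (use small in blast)
      then have "?d = 0" by simp
      have "(\<lambda>i. g i x) = (\<lambda>i. g i x0)" for x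
        using lipschitz_onD[OF lip, of x x0] L0 by (auto simp: fun_eq_iff)
      then have "common_descent (\<lambda>i. g i x) = 0" for x
        unfolding \<open>?d = 0\<close>[symmetric] by (rule arg_cong)
      then have "D K = 0" for K by (simp add: D_def)
      moreover have "0 \<le> mx"
        using L Cf \<rho> by (simp add: mx_def le_max_iff_disj)
      ultimately show ?thesis by (intro exI[of _ 1]) auto
    qed
    then show "\<exists>c>0. \<forall>K\<ge>1. 1 / A K * (\<Sum>k<K. \<alpha> k * (\<integral>w. (norm (common_descent (\<lambda>i. g i (xa K k w))))\<^sup>2 \<partial>M))
      \<le> c * (max (L * real CARD('m) * Cf\<^sup>2 * \<rho> * pi\<^sup>2 / 3) (2 * Mf / \<rho>) / ln (real K + 1))"
      by (simp only: D_def mx_def)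
  next
    fix D :: real
    assume "iid_samples M \<mu> \<xi>' \<and> (\<forall>k. iterate_assms M \<mu> f g G Cf \<delta> Finf (xb k))"
    then have iid: "iid_samples M \<mu> \<xi>'" and it: "\<And>k. iterate_assms M \<mu> f g G Cf \<delta> Finf (xb k)" by auto
    define W where "W K = (\<Sum>k<K. \<alpha> k * (\<integral>w. (norm (common_descent (\<lambda>i. g i (xb k w))))\<^sup>2 \<partial>M))" for K
    have W0: "0 \<le> W K" for K unfolding W_def by (rule nonneg)
    have xb: "xb k w = msmd Cf G (\<lambda>j. (j + 1)\<^sup>2) r (\<lambda>j _. \<theta> / (Mstar CARD('m) Cf \<delta> * sqrt (real ((j + 1)\<^sup>2))))
        (\<lambda>k. \<rho> / (real k + 1)) x0 (\<lambda>p. \<xi>' p w) k" for k w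
      by (simp only: xb_def \<gamma>_def \<alpha>_def)
    have S: "0 < (k + 1)\<^sup>2" for k :: nat by simp
    have WE: "W K \<le> Mf + E" for K
      using weighted_descent_le(2)[where \<xi>=\<xi>' and S="\<lambda>k. (k + 1)\<^sup>2" and x=xb and K=K,
          OF iid S order.refl \<rho> xb it] f_le
      unfolding W_def \<alpha>_def E_def by (meson add_right_mono order_trans)
    have C: "0 < Mf + E + 1" using WE[of 1] W0[of 1] by simp
    define z where "z = (\<Sum>k. 1 / (real k + 1) powr (3 / 2))"
    have "summable (\<lambda>k. 1 / (real k + 1) powr (3 / 2))"
      using summable_shifted_powr[of "- (3 / 2)"] by (simp add: powr_minus_divide)
    then have z: "0 < z" unfolding z_def by (rule suminf_pos) simp
    \<comment> \<open>The second entry of the maximum with \<open>M1\<close> taken at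
      \<open>k = 0\<close>, where \<open>S = 1\<close>. Every \<open>K \<ge> 1\<close> includes this
      index, so \<open>q\<close> is a positive lower bound of the maximum that is free of
      \<open>K\<close>.\<close>
    define q where "q = 2 * z * Cf * sqrt (M1 CARD('m) Cf \<delta> \<theta> r D ((0 + 1)\<^sup>2))"
    have q: "0 < q" unfolding q_def using z Cf M1_pos by simp
    define M1max where "M1max K = (MAX k\<in>{..<K}. M1 CARD('m) Cf \<delta> \<theta> r D ((k + 1)\<^sup>2))" for K
    define mx where "mx K = Max {L * real CARD('m) * Cf\<^sup>2 * \<rho> * pi\<^sup>2 / 3, 2 * z * Cf * sqrt (M1max K),
        2 * (\<Sum>k. 1 / (real k + 1) ^ 3) * L * \<rho> * M1max K, 2 * Mf / \<rho>}" for K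
    have qmx: "q \<le> mx K" if "1 \<le> K" for K
    proof -
      have "M1 CARD('m) Cf \<delta> \<theta> r D ((0 + 1)\<^sup>2) \<le> M1max K"
        unfolding M1max_def using that
        by (intro Max_ge image_eqI[where x=0]) auto
      then have "q \<le> 2 * z * Cf * sqrt (M1max K)"
        unfolding q_def using z Cf by (intro mult_left_mono real_sqrt_le_mono) auto
      also have "\<dots> \<le> mx K" unfolding mx_def by (rule Max_ge) auto
      finally show ?thesis .
    qed
    have "\<exists>c>0. \<forall>K\<ge>1. 1 / A K * W K \<le> c * (mx K * (1 / ln (real K + 1)))"
    proof (intro exI[of _ "(Mf + E + 1) / (\<rho> * q)"] conjI allI impI)
      show "0 < (Mf + E + 1) / (\<rho> * q)" using C q \<rho> by simp
      fix K :: nat assume K: "1 \<le> K"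
      have "1 / A K * W K \<le> (Mf + E + 1) / (\<rho> * ln (real K + 1))"
        using WE[of K] by (intro average_le W0 K) simp
      also have "\<dots> = (Mf + E + 1) / (\<rho> * q) * (q * (1 / ln (real K + 1)))"
        using q by simp
      also have "\<dots> \<le> (Mf + E + 1) / (\<rho> * q) * (mx K * (1 / ln (real K + 1)))"
        using C q \<rho> K qmx[OF K] by (intro mult_left_mono mult_right_mono) auto
      finally show "1 / A K * W K \<le> (Mf + E + 1) / (\<rho> * q) * (mx K * (1 / ln (real K + 1)))" .
    qed
    then show "\<exists>c>0. \<forall>K\<ge>1.
       (let M\<^sub>1 = (MAX k\<in>{..<K}. M1 CARD('m) Cf \<delta> \<theta> r D ((k + 1)\<^sup>2)) in
       1 / A K * (\<Sum>k<K. \<alpha> k * (\<integral>w. (norm (common_descent (\<lambda>i. g i (xb k w))))\<^sup>2 \<partial>M))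
         \<le> c * (Max {L * real CARD('m) * Cf\<^sup>2 * \<rho> * pi\<^sup>2 / 3,
                     2 * (\<Sum>k. 1 / (real k + 1) powr (3 / 2)) * Cf * sqrt M\<^sub>1,
                     2 * (\<Sum>k. 1 / (real k + 1) ^ 3) * L * \<rho> * M\<^sub>1,
                     2 * Mf / \<rho>} * (1 / ln (real K + 1))))"
      by (simp only: Let_def W_def mx_def z_def M1max_def)
  qed
qed

end
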